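(* Let $d\ge 1$ be an integer, $h>0$, $\sigma>0$, $1\le p\le +\infty$, $\lambda\in\{1,-1\}$, and let $V=\{V_n\}_{n\in h\mathbb{Z}^d}$ be a bounded real-valued sequence. Then the Cauchy problem for the discrete nonlinear Schr\"odinger equation $$ i u_n'(t)-\Delta_h u_n(t)+V_n u_n(t)+\lambda |u_n(t)|^{2\sigma}u_n(t)=0,\qquad u_n(0)=u_{n,0},\qquad n\in h\mathbb{Z}^d, $$ for complex-valued $u=\{u_n\}_{n\in h\mathbb{Z}^d}$, is globally well-posed in $l^p_h$. Moreover, for every $u_0=\{u_{n,0}\}\in l^p_h$ the solution satisfies $$ \|u(t)\|_{l^p_h}\le e^{2d|t|/h^2}\,\|u_0\|_{l^p_h}\qquad\text{for all } t\in\mathbb{R}. $$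
   Context: For a sequence $u=\{u_n\}_{n\in h\mathbb{Z}^d}$, $\|u\|_{l^p_h}=\big(\sum_{n\in h\mathbb{Z}^d}|u_n|^p\big)^{1/p}$ for $1\le p<\infty$ and $\|u\|_{l^\infty_h}=\sup_n|u_n|$; $l^p_h$ is the Banach space of sequences with finite norm. The discrete Laplacian is $\Delta_h u_n=\sum_{j=1}^d h^{-2}(u_{n+he_j}+u_{n-he_j}-2u_n)$, with $(e_j)$ the canonical basis of $\mathbb{R}^d$. Local well-posedness in a space $X_0$ (here $X_0=l^p_h$) means: (a) unconditional uniqueness: for each initial datum in $X_0$ and each time interval $I\ni 0$, there is at most one solution in $C(I;X_0)$; (b) for every initial datum $u_0\in X_0$ there exists a strong solution (a function in $C(I;X_0)$ satisfying the equation and the initial condition) on a maximal time interval $I=(-T_{\min},T_{\max})$ with $T_{\min},T_{\max}\in(0,+\infty]$; (c) the solution depends continuously on the initial value (in the standard sense: if $u_0^k\to u_0$ in $X_0$, then on each compact subinterval $J$ of the maximal interval of $u$ the solutions $u^k$ exist for large $k$ and converge to $u$ in $C(J;X_0)$). Global well-posedness means local well-posedness with maximal interval $I=\mathbb{R}$ for every initial datum. *)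

theory Defs
  imports "HOL-Analysis.Analysis"
begin

text \<open>The dimension $d$ is \<^term>\<open>CARD('d)\<close>. A sequence indexed by $h\mathbb{Z}^d$ is a function
  on \<open>real^'d\<close> of which only the values on the lattice matter: norms and equations see only
  lattice points, and equality of sequences is equality on the lattice.\<close>

definition lattice_h :: "real \<Rightarrow> (real^'d) set" where
  "lattice_h h = {h *\<^sub>R x |x. \<forall>j. x $ j \<in> \<int>}"

text \<open>The \<open>infsum\<close> of a non-summable family is 0 and the supremum of an unbounded set of reals is
  unspecified, so \<open>lp_norm\<close> is meaningful only on \<open>lp_space\<close>.\<close>

definition lp_norm :: "real \<Rightarrow> ereal \<Rightarrow> (real^'d \<Rightarrow> complex) \<Rightarrow> real" where
  "lp_norm h p u =
     (if p = \<infinity> then (SUP n\<in>lattice_h h. cmod (u n))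
      else (\<Sum>\<^sub>\<infinity>n\<in>lattice_h h. cmod (u n) powr real_of_ereal p) powr (1 / real_of_ereal p))"

definition lp_space :: "real \<Rightarrow> ereal \<Rightarrow> (real^'d \<Rightarrow> complex) set" where
  "lp_space h p =
     {u. if p = \<infinity> then bdd_above ((\<lambda>n. cmod (u n)) ` lattice_h h)
         else (\<lambda>n. cmod (u n) powr real_of_ereal p) summable_on lattice_h h}"

definition laplacian_h :: "real \<Rightarrow> (real^'d \<Rightarrow> complex) \<Rightarrow> (real^'d \<Rightarrow> complex)" where
  "laplacian_h h u n =
     (\<Sum>j\<in>UNIV. (1 / h\<^sup>2) *\<^sub>R (u (n + h *\<^sub>R axis j 1) + u (n - h *\<^sub>R axis j 1) - 2 * u n))"

text \<open>The time derivative is taken for each component; at an endpoint belonging to \<open>I\<close> it is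
  one-sided.\<close>

definition dnls_equation ::
    "real \<Rightarrow> (real^'d \<Rightarrow> real) \<Rightarrow> real \<Rightarrow> real \<Rightarrow> real set \<Rightarrow> (real \<Rightarrow> real^'d \<Rightarrow> complex) \<Rightarrow> bool" where
  "dnls_equation h V lam \<sigma> I u \<longleftrightarrow>
     (\<forall>t\<in>I. \<forall>n\<in>lattice_h h. \<exists>u'.
        ((\<lambda>s. u s n) has_vector_derivative u') (at t within I) \<and>
        \<i> * u' - laplacian_h h (u t) n + of_real (V n) * u t n
          + of_real lam * of_real (cmod (u t n) powr (2 * \<sigma>)) * u t n = 0)"

definition lp_continuous_on ::
    "real \<Rightarrow> ereal \<Rightarrow> real set \<Rightarrow> (real \<Rightarrow> real^'d \<Rightarrow> complex) \<Rightarrow> bool" where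
  "lp_continuous_on h p I u \<longleftrightarrow>
     (\<forall>t\<in>I. u t \<in> lp_space h p \<and>
        ((\<lambda>s. lp_norm h p (\<lambda>n. u s n - u t n)) \<longlongrightarrow> 0) (at t within I))"

text \<open>Below, \<open>E I u\<close> stands for: \<open>u\<close> satisfies the evolution equation \<open>E\<close> on the time interval \<open>I\<close>.\<close>

definition strong_solution ::
    "real \<Rightarrow> ereal \<Rightarrow> (real set \<Rightarrow> (real \<Rightarrow> real^'d \<Rightarrow> complex) \<Rightarrow> bool) \<Rightarrow>
     real set \<Rightarrow> (real^'d \<Rightarrow> complex) \<Rightarrow> (real \<Rightarrow> real^'d \<Rightarrow> complex) \<Rightarrow> bool" where
  "strong_solution h p E I u0 u \<longleftrightarrow>
     lp_continuous_on h p I u \<and> E I u \<and> (\<forall>n\<in>lattice_h h. u 0 n = u0 n)"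

text \<open>A strong solution on $(-T_{\min}, T_{\max})$ that has no extension to a strictly larger
  interval.\<close>

definition maximal_solution ::
    "real \<Rightarrow> ereal \<Rightarrow> (real set \<Rightarrow> (real \<Rightarrow> real^'d \<Rightarrow> complex) \<Rightarrow> bool) \<Rightarrow>
     ereal \<Rightarrow> ereal \<Rightarrow> (real^'d \<Rightarrow> complex) \<Rightarrow> (real \<Rightarrow> real^'d \<Rightarrow> complex) \<Rightarrow> bool" where
  "maximal_solution h p E Tmin Tmax u0 u \<longleftrightarrow>
     0 < Tmin \<and> 0 < Tmax \<and>
     strong_solution h p E (einterval (- Tmin) Tmax) u0 u \<and>
     \<not> (\<exists>J v. is_interval J \<and> einterval (- Tmin) Tmax \<subset> J \<and> strong_solution h p E J u0 v \<and>
           (\<forall>t\<in>einterval (- Tmin) Tmax. \<forall>n\<in>lattice_h h. v t n = u t n))"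

definition unconditional_uniqueness ::
    "real \<Rightarrow> ereal \<Rightarrow> (real set \<Rightarrow> (real \<Rightarrow> real^'d \<Rightarrow> complex) \<Rightarrow> bool) \<Rightarrow> bool" where
  "unconditional_uniqueness h p E \<longleftrightarrow>
     (\<forall>u0\<in>lp_space h p. \<forall>I u v. is_interval I \<and> 0 \<in> I \<and>
        strong_solution h p E I u0 u \<and> strong_solution h p E I u0 v \<longrightarrow>
        (\<forall>t\<in>I. \<forall>n\<in>lattice_h h. u t n = v t n))"

definition continuous_dependence ::
    "real \<Rightarrow> ereal \<Rightarrow> (real set \<Rightarrow> (real \<Rightarrow> real^'d \<Rightarrow> complex) \<Rightarrow> bool) \<Rightarrow> bool" where
  "continuous_dependence h p E \<longleftrightarrow>
     (\<forall>u0 u Tmin Tmax u0k uk Tmink Tmaxk.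
        u0 \<in> lp_space h p \<and> (\<forall>k::nat. u0k k \<in> lp_space h p) \<and>
        (\<lambda>k. lp_norm h p (\<lambda>n. u0k k n - u0 n)) \<longlonglongrightarrow> 0 \<and>
        maximal_solution h p E Tmin Tmax u0 u \<and>
        (\<forall>k. maximal_solution h p E (Tmink k) (Tmaxk k) (u0k k) (uk k)) \<longrightarrow>
        (\<forall>a b. {a..b} \<subseteq> einterval (- Tmin) Tmax \<longrightarrow>
           (\<forall>\<^sub>F k in sequentially. {a..b} \<subseteq> einterval (- Tmink k) (Tmaxk k)) \<and>
           uniform_limit {a..b} (\<lambda>k t. lp_norm h p (\<lambda>n. uk k t n - u t n)) (\<lambda>_. 0) sequentially))"

definition locally_well_posed ::
    "real \<Rightarrow> ereal \<Rightarrow> (real set \<Rightarrow> (real \<Rightarrow> real^'d \<Rightarrow> complex) \<Rightarrow> bool) \<Rightarrow> bool" where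
  "locally_well_posed h p E \<longleftrightarrow>
     unconditional_uniqueness h p E \<and>
     (\<forall>u0\<in>lp_space h p. \<exists>Tmin Tmax u. maximal_solution h p E Tmin Tmax u0 u) \<and>
     continuous_dependence h p E"

definition globally_well_posed ::
    "real \<Rightarrow> ereal \<Rightarrow> (real set \<Rightarrow> (real \<Rightarrow> real^'d \<Rightarrow> complex) \<Rightarrow> bool) \<Rightarrow> bool" where
  "globally_well_posed h p E \<longleftrightarrow>
     locally_well_posed h p E \<and>
     (\<forall>u0\<in>lp_space h p. \<forall>Tmin Tmax u.
        maximal_solution h p E Tmin Tmax u0 u \<longrightarrow> einterval (- Tmin) Tmax = UNIV)"

end

theory Submission
  imports Defs
begin

text \<open>All estimates are made componentwise. The terms of the equation that are diagonal with a real
  coefficient (the potential, the nonlinearity, the diagonal of the Laplacian) only rotate $u_n$, so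
  $|u|' \le B|u|$ where $B$ is $h^{-2}$ times the sum over the neighbours, and hence $|u(t)| \le e^{|t|B}|u(0)|$
  at every lattice point. By translation invariance and Minkowski's inequality $e^{|t|B}$ has norm at most
  $e^{2d|t|/h^2}$ on $l^p_h$. The same argument for the difference of two solutions, with $B$ increased by
  the Lipschitz constant of the nonlinearity, gives uniqueness and continuous dependence.

  For existence, $|u_n|$ is truncated in the nonlinearity at the a priori bound
  $e^{2d|t|/h^2}\|u_0\|_{l^p_h}$. Picard iteration in the supremum norm then gives a global solution, for
  which the truncation is inactive, and the domination by $e^{|t|B}|u_0|$ makes it continuous in $l^p_h$.\<close>

subsection \<open>The $l^p_h$ norm\<close>

text \<open>A differential inequality for the l^p norm itself is hard to come by: the equation is
  imposed only component by component, and the norm is not smooth for p = 1 or p = infinity. So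
  every component is dominated by one lattice function, and p enters only through monotonicity,
  translation invariance, Minkowski's inequality and pointwise limits. The components are coupled
  and infinitely many, so Gronwall's inequality at a single site does not close; a common finite
  bound on all components is what lets the iterated inequality start. Truncating only the amplitude
  leaves a real multiple of u_n, so the truncated equation obeys the same a priori bound and no
  continuation argument is needed. The truncation level depends on time and on the datum, not on the
  unknown, which makes the field globally Lipschitz in the supremum norm on bounded time intervals;
  l^p data are bounded, so one existence argument serves all p. A maximal solution must be global,
  since uniqueness identifies it with a restriction of the global one.\<close>

lemma lattice_h_0 [simp]: "0 \<in> lattice_h h"
  by (auto simp: lattice_h_def intro!: exI[of _ 0])

lemma lattice_h_add:
  assumes "m \<in> lattice_h h" "n \<in> lattice_h h"
  shows "m + n \<in> lattice_h h"
proof -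
  from assms obtain x y where "m = h *\<^sub>R x" "n = h *\<^sub>R y" "\<forall>j. x $ j \<in> \<int>" "\<forall>j. y $ j \<in> \<int>"
    by (auto simp: lattice_h_def)
  then show ?thesis
    by (auto simp: lattice_h_def scaleR_add_right intro!: exI[of _ "x + y"])
qed

lemma lattice_h_uminus:
  assumes "n \<in> lattice_h h"
  shows "- n \<in> lattice_h h"
proof -
  from assms obtain x where "n = h *\<^sub>R x" "\<forall>j. x $ j \<in> \<int>"
    by (auto simp: lattice_h_def)
  then show ?thesis
    by (auto simp: lattice_h_def intro!: exI[of _ "- x"])
qed

lemma lattice_h_axis: "h *\<^sub>R axis j 1 \<in> lattice_h h"
  unfolding lattice_h_def by (auto simp: axis_def intro!: exI[of _ "axis j 1"])

lemma lattice_h_neighbours [simp]: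
  assumes "n \<in> lattice_h h"
  shows "n + h *\<^sub>R axis j 1 \<in> lattice_h h" "n - h *\<^sub>R axis j 1 \<in> lattice_h h"
  using lattice_h_add[OF assms lattice_h_axis[of h j]]
    lattice_h_add[OF assms lattice_h_uminus[OF lattice_h_axis[of h j]]] by auto

lemma bij_betw_lattice_h_add:
  assumes "k \<in> lattice_h h"
  shows "bij_betw (\<lambda>n. n + k) (lattice_h h) (lattice_h h)"
proof (rule bij_betw_byWitness[where f' = "\<lambda>n. n + - k"])
  show "(\<lambda>n. n + k) ` lattice_h h \<subseteq> lattice_h h" "(\<lambda>n. n + - k) ` lattice_h h \<subseteq> lattice_h h"
    using lattice_h_add[OF _ assms] lattice_h_add[OF _ lattice_h_uminus[OF assms]] by auto
qed auto

text \<open>Membership is bundled with the bound because the value of \<open>lp_norm\<close> carries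
  no information outside \<open>lp_space\<close>. The pair is equivalent to a family of finite
  inequalities, which makes it stable under domination, sums and limits.\<close>

definition lp_le :: "real \<Rightarrow> ereal \<Rightarrow> real \<Rightarrow> (real^'d \<Rightarrow> complex) \<Rightarrow> bool" where
  "lp_le h p C u \<longleftrightarrow> u \<in> lp_space h p \<and> lp_norm h p u \<le> C"

lemma lp_norm_nonneg:
  assumes "u \<in> lp_space h p"
  shows "0 \<le> lp_norm h p u"
proof (cases "p = \<infinity>")
  case True
  then have "bdd_above ((\<lambda>n. cmod (u n)) ` lattice_h h)"
    using assms by (simp add: lp_space_def)
  from cSUP_upper[OF lattice_h_0 this] show ?thesis
    using True by (simp add: lp_norm_def order_trans[OF norm_ge_zero])
qed (simp add: lp_norm_def)

lemma lp_le_nonneg: "lp_le h p C u \<Longrightarrow> 0 \<le> C"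
  unfolding lp_le_def using lp_norm_nonneg by force

lemma lp_le_infinity: "lp_le h \<infinity> C u \<longleftrightarrow> (\<forall>n\<in>lattice_h h. cmod (u n) \<le> C)"
proof
  assume "lp_le h \<infinity> C u"
  then have "bdd_above ((\<lambda>n. cmod (u n)) ` lattice_h h)" "(SUP n\<in>lattice_h h. cmod (u n)) \<le> C"
    by (auto simp: lp_le_def lp_space_def lp_norm_def)
  then show "\<forall>n\<in>lattice_h h. cmod (u n) \<le> C"
    by (meson cSUP_upper order_trans)
next
  assume *: "\<forall>n\<in>lattice_h h. cmod (u n) \<le> C"
  then have "(SUP n\<in>lattice_h h. cmod (u n)) \<le> C"
    by (intro cSUP_least) (use lattice_h_0[of h] in \<open>auto simp del: lattice_h_0\<close>)
  with * show "lp_le h \<infinity> C u"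
    by (auto simp: lp_le_def lp_space_def lp_norm_def intro!: bdd_aboveI2)
qed

text \<open>The terms are nonnegative, so the infinite sum is the supremum of its finite partial
  sums; \<open>0 \<le> C\<close> allows the power \<open>q\<close> to be undone.\<close>

lemma lp_le_ereal:
  assumes "1 \<le> q" "0 \<le> C"
  shows "lp_le h (ereal q) C u \<longleftrightarrow>
    (\<forall>F. finite F \<longrightarrow> F \<subseteq> lattice_h h \<longrightarrow> (\<Sum>n\<in>F. cmod (u n) powr q) \<le> C powr q)"
proof
  assume le: "lp_le h (ereal q) C u"
  let ?S = "\<Sum>\<^sub>\<infinity>n\<in>lattice_h h. cmod (u n) powr q"
  from le have s: "(\<lambda>n. cmod (u n) powr q) summable_on lattice_h h" and b: "?S powr (1/q) \<le> C"
    by (auto simp: lp_le_def lp_space_def lp_norm_def)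
  have "0 \<le> ?S" by (simp add: infsum_nonneg)
  then have "?S = (?S powr (1/q)) powr q"
    using assms by (simp add: powr_powr)
  also have "\<dots> \<le> C powr q"
    using b assms by (intro powr_mono2) auto
  finally have "?S \<le> C powr q" .
  then show "\<forall>F. finite F \<longrightarrow> F \<subseteq> lattice_h h \<longrightarrow> (\<Sum>n\<in>F. cmod (u n) powr q) \<le> C powr q"
    using finite_sum_le_infsum[OF s] by (meson order_trans powr_ge_zero)
next
  assume *: "\<forall>F. finite F \<longrightarrow> F \<subseteq> lattice_h h \<longrightarrow> (\<Sum>n\<in>F. cmod (u n) powr q) \<le> C powr q"
  let ?S = "\<Sum>\<^sub>\<infinity>n\<in>lattice_h h. cmod (u n) powr q"
  have s: "(\<lambda>n. cmod (u n) powr q) summable_on lattice_h h"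
    using * by (intro nonneg_bdd_above_summable_on) (auto intro!: bdd_aboveI2[where M = "C powr q"])
  have "?S \<le> C powr q"
    using * by (intro infsum_le_finite_sums[OF s]) auto
  then have "?S powr (1/q) \<le> (C powr q) powr (1/q)"
    using assms by (intro powr_mono2) (auto intro!: infsum_nonneg)
  also have "\<dots> = C"
    using assms by (simp add: powr_powr)
  finally show "lp_le h (ereal q) C u"
    using s by (simp add: lp_le_def lp_space_def lp_norm_def)
qed

lemma lp_exponent_cases:
  assumes "(1::ereal) \<le> p"
  obtains "p = \<infinity>" | q where "p = ereal q" "1 \<le> q"
  using assms by (cases p) auto

text \<open>Converts pointwise domination on the lattice into a norm bound. It also serves to
  exchange functions that agree on the lattice only.\<close>

lemma lp_le_mono:
  assumes "1 \<le> p" "lp_le h p C v" "C \<le> D" "\<And>n. n \<in> lattice_h h \<Longrightarrow> cmod (u n) \<le> cmod (v n)"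
  shows "lp_le h p D u"
proof -
  note C = lp_le_nonneg[OF assms(2)]
  have D: "0 \<le> D" using C assms(3) by simp
  from assms(1) show ?thesis
  proof (cases rule: lp_exponent_cases)
    case 1
    then show ?thesis
      using assms by (simp add: lp_le_infinity) (meson order_trans)
  next
    case (2 q)
    show ?thesis
      unfolding \<open>p = ereal q\<close> lp_le_ereal[OF \<open>1 \<le> q\<close> D]
    proof (intro allI impI)
      fix F :: "(real^'a) set"
      assume F: "finite F" "F \<subseteq> lattice_h h"
      have "(\<Sum>n\<in>F. cmod (u n) powr q) \<le> (\<Sum>n\<in>F. cmod (v n) powr q)"
        using F assms(4) \<open>1 \<le> q\<close> by (intro sum_mono powr_mono2) auto
      also have "\<dots> \<le> C powr q"
        using assms(2) F unfolding \<open>p = ereal q\<close> lp_le_ereal[OF \<open>1 \<le> q\<close> C] by blast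
      also have "\<dots> \<le> D powr q"
        using C assms(3) \<open>1 \<le> q\<close> by (intro powr_mono2) auto
      finally show "(\<Sum>n\<in>F. cmod (u n) powr q) \<le> D powr q" .
    qed
  qed
qed

text \<open>A singleton as test set gives the embedding of l^p into l^infinity with constant 1,
  through which supremum estimates become available for every p.\<close>

lemma lp_le_coord:
  assumes "1 \<le> p" "lp_le h p C u" "n \<in> lattice_h h"
  shows "cmod (u n) \<le> C"
  using assms(1)
proof (cases rule: lp_exponent_cases)
  case 1
  then show ?thesis using assms by (simp add: lp_le_infinity)
next
  case (2 q)
  note C = lp_le_nonneg[OF assms(2)]
  have "(\<Sum>n\<in>{n}. cmod (u n) powr q) \<le> C powr q"
    using assms(2,3) unfolding \<open>p = ereal q\<close> lp_le_ereal[OF \<open>1 \<le> q\<close> C] by blast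
  then show ?thesis
    using \<open>1 \<le> q\<close> C powr_less_mono2[of q C "cmod (u n)"] by (cases "C < cmod (u n)") auto
qed

lemma lp_le_scaleR:
  assumes "1 \<le> p" "lp_le h p C u"
  shows "lp_le h p (\<bar>a\<bar> * C) (\<lambda>n. a *\<^sub>R u n)"
  using assms(1)
proof (cases rule: lp_exponent_cases)
  case 1
  then show ?thesis using assms by (simp add: lp_le_infinity mult_left_mono)
next
  case (2 q)
  note C = lp_le_nonneg[OF assms(2)]
  then have aC: "0 \<le> \<bar>a\<bar> * C" by simp
  show ?thesis
    using assms(2) C unfolding \<open>p = ereal q\<close> lp_le_ereal[OF \<open>1 \<le> q\<close> C] lp_le_ereal[OF \<open>1 \<le> q\<close> aC]
    by (simp add: powr_mult mult_left_mono flip: sum_distrib_left)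
qed

lemma lp_le_shift:
  assumes "1 \<le> p" "lp_le h p C u" "k \<in> lattice_h h"
  shows "lp_le h p C (\<lambda>n. u (n + k))"
  using assms(1)
proof (cases rule: lp_exponent_cases)
  case 1
  then show ?thesis using assms lattice_h_add by (auto simp: lp_le_infinity)
next
  case (2 q)
  note bij = bij_betw_lattice_h_add[OF assms(3)]
  show ?thesis
    using assms(2) 2 summable_on_reindex_bij_betw[OF bij, of "\<lambda>n. cmod (u n) powr q"]
      infsum_reindex_bij_betw[OF bij, of "\<lambda>n. cmod (u n) powr q"]
    by (auto simp: lp_le_def lp_space_def lp_norm_def)
qed

text \<open>With one argument equal to 0 the inequality reduces to t^q \<le> t for 0 < t < 1;
  otherwise it is convexity on the positive reals. The endpoint matters because sequences may vanish
  at lattice points.\<close>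

lemma powr_convex_nonneg:
  fixes q :: real
  assumes "1 \<le> q"
  shows "convex_on {0..} (\<lambda>x. x powr q)"
proof (rule convex_onI)
  have shrink: "(t * y) powr q \<le> t * y powr q" if "0 < t" "t < 1" "0 \<le> y" for t y :: real
  proof -
    have "t powr q \<le> t powr 1"
      using that assms by (intro powr_mono') auto
    then show ?thesis
      using that by (simp add: powr_mult mult_right_mono)
  qed
  fix t x y :: real
  assume t: "0 < t" "t < 1" and xy: "x \<in> {0..}" "y \<in> {0..}"
  show "((1 - t) *\<^sub>R x + t *\<^sub>R y) powr q \<le> (1 - t) * x powr q + t * y powr q"
  proof (cases "x = 0 \<or> y = 0")
    case True
    then show ?thesis
      using shrink[of t y] shrink[of "1 - t" x] t xy assms by auto
  next
    case False
    then show ?thesis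
      using convex_onD[OF powr_convex[OF assms], of t x y] t xy by auto
  qed
qed simp

text \<open>Minkowski's inequality by convexity: |u| + |v| is (A + B) times the convex combination
  of |u|/A and |v|/B with weights A/(A + B) and B/(A + B). Positive bounds permit the
  division.\<close>

lemma lp_le_add_pos:
  assumes "1 \<le> q" "0 < A" "0 < B" "lp_le h (ereal q) A u" "lp_le h (ereal q) B v"
  shows "lp_le h (ereal q) (A + B) (\<lambda>n. u n + v n)"
proof -
  have A: "0 \<le> A" and B: "0 \<le> B" and AB: "0 \<le> A + B" using assms by auto
  define t where "t = B / (A + B)"
  have t: "0 \<le> t" "t \<le> 1" and t1: "1 - t = A / (A + B)"
    using assms by (auto simp: t_def field_simps)
  have pt: "cmod (u n + v n) powr q \<le>
      (A + B) powr q * ((1 - t) * (cmod (u n) powr q / A powr q) + t * (cmod (v n) powr q / B powr q))"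
    for n
  proof -
    have eq: "cmod (u n) + cmod (v n) = (A + B) * ((1 - t) * (cmod (u n) / A) + t * (cmod (v n) / B))"
    proof -
      have "(A + B) * ((1 - t) * x + t * y) = A * x + B * y" for x y
        using assms unfolding t1 by (simp add: t_def distrib_left)
      from this[of "cmod (u n) / A" "cmod (v n) / B"] show ?thesis using assms by simp
    qed
    have "((1 - t) * (cmod (u n) / A) + t * (cmod (v n) / B)) powr q
        \<le> (1 - t) * (cmod (u n) / A) powr q + t * (cmod (v n) / B) powr q"
      using convex_onD[OF powr_convex_nonneg[OF assms(1)] t, of "cmod (u n) / A" "cmod (v n) / B"]
        assms by simp
    also have "\<dots> = (1 - t) * (cmod (u n) powr q / A powr q) + t * (cmod (v n) powr q / B powr q)"
      using assms by (simp add: powr_divide)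
    finally have *: "((1 - t) * (cmod (u n) / A) + t * (cmod (v n) / B)) powr q \<le> \<dots>" .
    have "cmod (u n + v n) powr q \<le> (cmod (u n) + cmod (v n)) powr q"
      using assms(1) by (intro powr_mono2 norm_triangle_ineq) auto
    also have "\<dots> = (A + B) powr q * ((1 - t) * (cmod (u n) / A) + t * (cmod (v n) / B)) powr q"
      unfolding eq by (rule powr_mult)
    also have "\<dots> \<le> (A + B) powr q *
        ((1 - t) * (cmod (u n) powr q / A powr q) + t * (cmod (v n) powr q / B powr q))"
      by (intro mult_left_mono *) auto
    finally show ?thesis .
  qed
  show ?thesis
    unfolding lp_le_ereal[OF assms(1) AB]
  proof (intro allI impI)
    fix F :: "(real^'a) set"
    assume F: "finite F" "F \<subseteq> lattice_h h"
    have a: "(\<Sum>n\<in>F. cmod (u n) powr q) / A powr q \<le> 1"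
      using assms(2,4) F unfolding lp_le_ereal[OF assms(1) A] by (simp add: divide_le_eq)
    have b: "(\<Sum>n\<in>F. cmod (v n) powr q) / B powr q \<le> 1"
      using assms(3,5) F unfolding lp_le_ereal[OF assms(1) B] by (simp add: divide_le_eq)
    have "(\<Sum>n\<in>F. cmod (u n + v n) powr q) \<le> (\<Sum>n\<in>F. (A + B) powr q *
        ((1 - t) * (cmod (u n) powr q / A powr q) + t * (cmod (v n) powr q / B powr q)))"
      by (intro sum_mono pt)
    also have "\<dots> = (A + B) powr q * ((1 - t) * ((\<Sum>n\<in>F. cmod (u n) powr q) / A powr q)
        + t * ((\<Sum>n\<in>F. cmod (v n) powr q) / B powr q))"
      by (simp only: sum.distrib sum_distrib_left sum_divide_distrib distrib_left)
    also have "\<dots> \<le> (A + B) powr q * ((1 - t) * 1 + t * 1)"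
      using a b t by (intro mult_left_mono add_mono) auto
    finally show "(\<Sum>n\<in>F. cmod (u n + v n) powr q) \<le> (A + B) powr q" by simp
  qed
qed

lemma lp_le_add:
  assumes "1 \<le> p" "lp_le h p A u" "lp_le h p B v"
  shows "lp_le h p (A + B) (\<lambda>n. u n + v n)"
  using assms(1)
proof (cases rule: lp_exponent_cases)
  case 1
  then show ?thesis
    using assms by (simp add: lp_le_infinity norm_triangle_mono)
next
  case (2 q)
  \<comment> \<open>A bound may be 0, so both are enlarged by a positive \<open>e\<close>. A single
    \<open>e\<close> yields membership; letting \<open>e\<close> shrink yields the norm
    bound.\<close>
  have *: "lp_le h p (A + e + (B + e)) (\<lambda>n. u n + v n)" if "0 < e" for e
    using lp_le_nonneg[OF assms(2)] lp_le_nonneg[OF assms(3)] that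
      lp_le_mono[OF assms(1,2), of "A + e" u] lp_le_mono[OF assms(1,3), of "B + e" v]
    unfolding \<open>p = ereal q\<close> by (intro lp_le_add_pos[OF \<open>1 \<le> q\<close>]) auto
  then have "(\<lambda>n. u n + v n) \<in> lp_space h p" by (meson lp_le_def zero_less_one)
  moreover have "lp_norm h p (\<lambda>n. u n + v n) \<le> A + B"
  proof (rule field_le_epsilon)
    fix e :: real assume "0 < e"
    with *[of "e / 2"] show "lp_norm h p (\<lambda>n. u n + v n) \<le> A + B + e"
      by (simp add: lp_le_def algebra_simps)
  qed
  ultimately show ?thesis by (simp add: lp_le_def)
qed

lemma lp_le_zero:
  assumes "1 \<le> p"
  shows "lp_le h p 0 (\<lambda>n. 0)"
  using assms
proof (cases rule: lp_exponent_cases)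
  case (2 q)
  then show ?thesis by (simp add: lp_le_ereal)
qed (simp add: lp_le_infinity)

lemma lp_le_sum:
  assumes "1 \<le> p" "\<And>i. i \<in> I \<Longrightarrow> lp_le h p (C i) (u i)"
  shows "lp_le h p (\<Sum>i\<in>I. C i) (\<lambda>n. \<Sum>i\<in>I. u i n)"
  using assms(2)
\<comment> \<open>Over an infinite index set both sums are 0 by default, which leaves the bound 0
  for the zero sequence.\<close>
proof (induction I rule: infinite_finite_induct)
  case (insert i I)
  then show ?case
    using lp_le_add[OF assms(1), of h "C i" "u i" "\<Sum>i\<in>I. C i" "\<lambda>n. \<Sum>i\<in>I. u i n"] by simp
qed (use lp_le_zero[OF assms(1)] in auto)

text \<open>A Fatou property: the bound is tested on finite sets, where pointwise limits pass
  through the sum. No convergence in l^p is required.\<close>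

lemma lp_le_limit:
  assumes "1 \<le> p" "\<And>k::nat. lp_le h p C (u k)"
    and "\<And>n. n \<in> lattice_h h \<Longrightarrow> (\<lambda>k. u k n) \<longlonglongrightarrow> v n"
  shows "lp_le h p C v"
  using assms(1)
proof (cases rule: lp_exponent_cases)
  case 1
  then show ?thesis
    using assms(2) LIMSEQ_le_const2[OF tendsto_norm[OF assms(3)]] by (auto simp: lp_le_infinity)
next
  case (2 q)
  note C = lp_le_nonneg[OF assms(2)]
  show ?thesis
    unfolding \<open>p = ereal q\<close> lp_le_ereal[OF \<open>1 \<le> q\<close> C]
  proof (intro allI impI)
    fix F :: "(real^'a) set"
    assume F: "finite F" "F \<subseteq> lattice_h h"
    have "(\<lambda>k. \<Sum>n\<in>F. cmod (u k n) powr q) \<longlonglongrightarrow> (\<Sum>n\<in>F. cmod (v n) powr q)"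
      using F \<open>1 \<le> q\<close> by (intro tendsto_sum tendsto_powr' tendsto_norm assms(3)) auto
    moreover have "(\<Sum>n\<in>F. cmod (u k n) powr q) \<le> C powr q" for k
      using assms(2) F unfolding \<open>p = ereal q\<close> lp_le_ereal[OF \<open>1 \<le> q\<close> C] by blast
    ultimately show "(\<Sum>n\<in>F. cmod (v n) powr q) \<le> C powr q"
      by (intro LIMSEQ_le_const2) auto
  qed
qed

lemma lp_le_lp_norm: "u \<in> lp_space h p \<Longrightarrow> lp_le h p (lp_norm h p u) u"
  by (simp add: lp_le_def)

subsection \<open>A comparison principle\<close>

text \<open>The modulus is not differentiable at zeros of \<open>w\<close>, so it is replaced by r =
  sqrt(|w|^2 + e^2). Then r' = Re(cnj w * w')/r \<le> |w| G/r \<le> G because G is nonnegative, so r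
  - \<Phi> is nonincreasing; finally \<open>e\<close> is arbitrary.\<close>

lemma norm_le_of_derivative:
  fixes w w' :: "real \<Rightarrow> complex" and \<Phi> G :: "real \<Rightarrow> real"
  assumes w: "\<And>s. s \<in> {0..1} \<Longrightarrow> (w has_vector_derivative w' s) (at s within {0..1})"
    and \<Phi>: "\<And>s. s \<in> {0..1} \<Longrightarrow> (\<Phi> has_real_derivative G s) (at s within {0..1})"
    and le: "\<And>s. s \<in> {0..1} \<Longrightarrow> Re (cnj (w s) * w' s) \<le> cmod (w s) * G s"
    and G: "\<And>s. s \<in> {0..1} \<Longrightarrow> 0 \<le> G s"
    and t: "t \<in> {0..1}"
  shows "cmod (w t) \<le> cmod (w 0) + (\<Phi> t - \<Phi> 0)"
proof (rule field_le_epsilon)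
  fix e :: real
  assume e: "0 < e"
  define r where "r s = sqrt ((cmod (w s))\<^sup>2 + e\<^sup>2)" for s
  have r_eq: "r = (\<lambda>s. sqrt ((Re (w s))\<^sup>2 + (Im (w s))\<^sup>2 + e\<^sup>2))"
    by (simp add: r_def cmod_power2 fun_eq_iff)
  have rpos: "0 < r s" and wr: "cmod (w s) \<le> r s" for s
    using e by (auto simp: r_def add_nonneg_pos intro!: real_le_rsqrt)
  have "(r has_real_derivative Re (cnj (w s) * w' s) / r s) (at s within {0..1})"
    if "s \<in> {0..1}" for s
  proof -
    have pos: "0 < (Re (w s))\<^sup>2 + (Im (w s))\<^sup>2 + e\<^sup>2"
      using e by (intro add_nonneg_pos) auto
    have "((\<lambda>s. (Re (w s))\<^sup>2 + (Im (w s))\<^sup>2 + e\<^sup>2) has_real_derivative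
        2 * Re (cnj (w s) * w' s)) (at s within {0..1})"
      by (auto intro!: derivative_eq_intros w[OF that] simp: algebra_simps)
    note d = DERIV_chain2[OF DERIV_real_sqrt[OF pos] this]
    have eq: "inverse x / 2 * (2 * y) = y / x" for x y :: real
      by (simp add: field_simps)
    from d
    have "((\<lambda>s. sqrt ((Re (w s))\<^sup>2 + (Im (w s))\<^sup>2 + e\<^sup>2)) has_real_derivative
        Re (cnj (w s) * w' s) / sqrt ((Re (w s))\<^sup>2 + (Im (w s))\<^sup>2 + e\<^sup>2)) (at s within {0..1})"
      by (rule DERIV_cong) (simp only: eq)
    then show ?thesis
      unfolding r_eq .
  qed
  then have D: "((\<lambda>s. r s - \<Phi> s) has_real_derivative Re (cnj (w s) * w' s) / r s - G s)
      (at s within {0..1})" if "s \<in> {0..1}" for s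
    using \<Phi> that by (intro DERIV_diff) auto
  have "r t - \<Phi> t \<le> r 0 - \<Phi> 0"
  proof (rule DERIV_nonpos_imp_decreasing_open[where f = "\<lambda>s. r s - \<Phi> s"])
    show "0 \<le> t" using t by simp
    show "continuous_on {0..t} (\<lambda>s. r s - \<Phi> s)"
    proof (rule continuous_on_subset)
      show "continuous_on {0..1} (\<lambda>s. r s - \<Phi> s)"
        by (rule DERIV_continuous_on) (rule D)
    qed (use t in auto)
    fix s assume s: "0 < s" "s < t"
    then have s01: "s \<in> {0..1}" using t by simp
    have "Re (cnj (w s) * w' s) \<le> r s * G s"
      using le[OF s01] wr[of s] G[OF s01] by (meson mult_right_mono order_trans)
    then have "Re (cnj (w s) * w' s) / r s - G s \<le> 0"
      using rpos[of s] by (simp add: divide_le_eq mult.commute)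
    then show "\<exists>y. DERIV (\<lambda>s. r s - \<Phi> s) s :> y \<and> y \<le> 0"
      using D[OF s01] s t by (auto simp: at_within_Icc_at)
  qed
  moreover have "r 0 \<le> cmod (w 0) + e"
    unfolding r_def using e by (intro real_le_lsqrt) (auto simp: power2_sum)
  ultimately show "cmod (w t) \<le> cmod (w 0) + (\<Phi> t - \<Phi> 0) + e"
    using wr[of t] by simp
qed

section \<open>Sums over lattice neighbours and the exponential of the comparison operator\<close>

definition neighbour_sum ::
    "real \<Rightarrow> (real^'d \<Rightarrow> 'a::real_vector) \<Rightarrow> real^'d \<Rightarrow> 'a" where
  "neighbour_sum h c n = (\<Sum>j\<in>UNIV. c (n + h *\<^sub>R axis j 1) + c (n - h *\<^sub>R axis j 1))"

lemma neighbour_sum_mono: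
  fixes b c :: "real^'d \<Rightarrow> real"
  assumes "\<And>m. m \<in> lattice_h h \<Longrightarrow> b m \<le> c m" "n \<in> lattice_h h"
  shows "neighbour_sum h b n \<le> neighbour_sum h c n"
  unfolding neighbour_sum_def using assms by (intro sum_mono add_mono) auto

lemma neighbour_sum_const:
  fixes c :: real
  shows "neighbour_sum h (\<lambda>_::real^'d. c) n = 2 * real CARD('d) * c"
  by (simp add: neighbour_sum_def)

lemma neighbour_sum_diff:
  "neighbour_sum h (\<lambda>m. b m - c m) n = neighbour_sum h b n - neighbour_sum h c n"
  by (simp add: neighbour_sum_def sum_subtractf [symmetric] algebra_simps)

lemma neighbour_sum_sum:
  "neighbour_sum h (\<lambda>m. \<Sum>i\<in>I. r i *\<^sub>R c i m) n = (\<Sum>i\<in>I. r i *\<^sub>R neighbour_sum h (c i) n)"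
  unfolding neighbour_sum_def
  by (simp add: scaleR_sum_right scaleR_add_right sum.distrib sum.swap[of _ I])

lemma neighbour_sum_add:
  "neighbour_sum h (\<lambda>m. b m + c m) n = neighbour_sum h b n + neighbour_sum h c n"
  by (simp add: neighbour_sum_def sum.distrib [symmetric] algebra_simps)

lemma norm_neighbour_sum_le:
  fixes c :: "real^'d \<Rightarrow> complex"
  shows "cmod (neighbour_sum h c n) \<le> neighbour_sum h (\<lambda>m. cmod (c m)) n"
  unfolding neighbour_sum_def by (intro sum_norm_le norm_triangle_ineq)

text \<open>The generator of the comparison semigroup: \<open>a\<close> weights the neighbours, and
  \<open>L\<close> collects whatever acts at the site itself without being a rotation. It preserves
  order and multiplies constants by 2da + L.\<close>

definition hop :: "real \<Rightarrow> real \<Rightarrow> real \<Rightarrow> (real^'d \<Rightarrow> real) \<Rightarrow> real^'d \<Rightarrow> real" where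
  "hop h a L c n = a * neighbour_sum h c n + L * c n"

text \<open>The operator exponential, as a series at each site, so that no operator norm is
  involved. Elapsed time is absorbed into \<open>a\<close> and \<open>L\<close>.\<close>

definition hop_exp :: "real \<Rightarrow> real \<Rightarrow> real \<Rightarrow> (real^'d \<Rightarrow> real) \<Rightarrow> real^'d \<Rightarrow> real" where
  "hop_exp h a L c n = (\<Sum>k. (hop h a L ^^ k) c n / fact k)"

lemma hop_mono:
  assumes "0 \<le> a" "0 \<le> L" "\<And>m. m \<in> lattice_h h \<Longrightarrow> b m \<le> c m" "n \<in> lattice_h h"
  shows "hop h a L b n \<le> hop h a L c n"
  unfolding hop_def using assms by (intro add_mono mult_left_mono neighbour_sum_mono) auto

lemma hop_const: "hop h a L (\<lambda>_::real^'d. c) n = (2 * real CARD('d) * a + L) * c"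
  by (simp add: hop_def neighbour_sum_const algebra_simps)

lemma hop_power_bounds:
  fixes c :: "real^'d \<Rightarrow> real"
  assumes "0 \<le> a" "0 \<le> L" "\<And>m. m \<in> lattice_h h \<Longrightarrow> 0 \<le> c m \<and> c m \<le> S" "n \<in> lattice_h h"
  shows "0 \<le> (hop h a L ^^ k) c n" "(hop h a L ^^ k) c n \<le> (2 * real CARD('d) * a + L) ^ k * S"
proof -
  have "\<forall>n\<in>lattice_h h. 0 \<le> (hop h a L ^^ k) c n \<and>
    (hop h a L ^^ k) c n \<le> (2 * real CARD('d) * a + L) ^ k * S"
  proof (induction k)
    case 0
    then show ?case using assms(3) by auto
  next
    case (Suc k)
    then show ?case
      using hop_mono[OF assms(1,2), of h "\<lambda>_. 0" "(hop h a L ^^ k) c"]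
        hop_mono[OF assms(1,2), of h "(hop h a L ^^ k) c" "\<lambda>_. (2 * real CARD('d) * a + L) ^ k * S"]
      by (auto simp: hop_const mult.assoc)
  qed
  then show "0 \<le> (hop h a L ^^ k) c n" "(hop h a L ^^ k) c n \<le> (2 * real CARD('d) * a + L) ^ k * S"
    using assms(4) by auto
qed

lemma summable_hop_exp:
  fixes c :: "real^'d \<Rightarrow> real"
  assumes "0 \<le> a" "0 \<le> L" "\<And>m. m \<in> lattice_h h \<Longrightarrow> 0 \<le> c m \<and> c m \<le> S" "n \<in> lattice_h h"
  shows "summable (\<lambda>k. (hop h a L ^^ k) c n / fact k)"
proof (rule summable_comparison_test')
  show "summable (\<lambda>k. S * (inverse (fact k) * (2 * real CARD('d) * a + L) ^ k))"
    by (intro summable_mult summable_exp)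
  show "norm ((hop h a L ^^ k) c n / fact k) \<le> S * (inverse (fact k) * (2 * real CARD('d) * a + L) ^ k)"
    for k
    using hop_power_bounds[OF assms, where k = k] by (simp add: field_simps)
qed

text \<open>Constants are eigenvectors with eigenvalue 2da + L, so a remainder independent of the
  site remains so.\<close>

lemma hop_Taylor:
  fixes c :: "real^'d \<Rightarrow> real"
  shows "hop h a L (\<lambda>m. (\<Sum>i<k. r i * (hop h a L ^^ i) c m) + R) n =
    (\<Sum>i<k. r i * (hop h a L ^^ Suc i) c n) + (2 * real CARD('d) * a + L) * R"
proof -
  have "neighbour_sum h (\<lambda>m. (\<Sum>i<k. r i * (hop h a L ^^ i) c m) + R) n =
    (\<Sum>i<k. r i * neighbour_sum h ((hop h a L ^^ i) c) n) + 2 * real CARD('d) * R"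
    using neighbour_sum_sum[of h r "\<lambda>i. (hop h a L ^^ i) c" "{..<k}" n]
    by (simp add: neighbour_sum_add neighbour_sum_const)
  moreover have "(hop h a L ^^ Suc i) c n = a * neighbour_sum h ((hop h a L ^^ i) c) n + L * (hop h a L ^^ i) c n" for i
    by (simp add: hop_def)
  ultimately show ?thesis
    unfolding hop_def[of h a L "\<lambda>m. (\<Sum>i<k. r i * (hop h a L ^^ i) c m) + R"]
    by (simp add: sum.distrib sum_distrib_left algebra_simps)
qed

text \<open>Integrating the differential inequality $|w|' \le B|w|$ repeatedly, starting from the crude
  bound $|w| \le M$, yields the Taylor sums of $e^{sB}|w(0)|$ with remainder $M(\beta s)^k/k!$.\<close>

lemma comparison_unit_interval:
  fixes w :: "real \<Rightarrow> real^'d \<Rightarrow> complex"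
  assumes aL: "0 \<le> a" "0 \<le> L"
    and der: "\<And>s n. s \<in> {0..1} \<Longrightarrow> n \<in> lattice_h h \<Longrightarrow>
        ((\<lambda>s. w s n) has_vector_derivative w' s n) (at s within {0..1})"
    and le: "\<And>s n. s \<in> {0..1} \<Longrightarrow> n \<in> lattice_h h \<Longrightarrow>
        Re (cnj (w s n) * w' s n) \<le> cmod (w s n) * hop h a L (\<lambda>m. cmod (w s m)) n"
    and bd: "\<And>s n. s \<in> {0..1} \<Longrightarrow> n \<in> lattice_h h \<Longrightarrow> cmod (w s n) \<le> M"
    and s: "s \<in> {0..1}" and n: "n \<in> lattice_h h"
  shows "cmod (w s n) \<le> hop_exp h a L (\<lambda>m. cmod (w 0 m)) n"
proof -
  define c where "c = (\<lambda>m. cmod (w 0 m))"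
  define \<beta> where "\<beta> = 2 * real CARD('d) * a + L"
  define P where "P k s n = (\<Sum>i<k. s ^ i / fact i * (hop h a L ^^ i) c n) + M * (\<beta> * s) ^ k / fact k"
    for k s n
  have c: "0 \<le> c m \<and> c m \<le> M" if "m \<in> lattice_h h" for m
    using bd[of 0 m] that by (simp add: c_def)
  have M: "0 \<le> M" using c[OF n] by simp
  have \<beta>: "0 \<le> \<beta>" using aL by (simp add: \<beta>_def)
  \<comment> \<open>The functions \<open>P k\<close> are the Picard iterates of y' =
    \<open>hop\<close> y with y(0) = \<open>c\<close>, starting from the constant
    \<open>M\<close>.\<close>
  have P': "((\<lambda>s. P (Suc k) s n) has_real_derivative hop h a L (P k s) n) (at s within {0..1})" for k s n
  proof -
    have pow: "((\<lambda>s. s ^ Suc i / fact (Suc i)) has_real_derivative s ^ i / fact i) (at s within {0..1})" for i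
      by (rule derivative_eq_intros refl | simp add: field_simps del: of_nat_Suc)+
    have "((\<lambda>s. (\<Sum>i<k. s ^ Suc i / fact (Suc i) * (hop h a L ^^ Suc i) c n) + c n +
          M * \<beta> ^ Suc k * (s ^ Suc k / fact (Suc k))) has_real_derivative
        (\<Sum>i<k. s ^ i / fact i * (hop h a L ^^ Suc i) c n) + 0 + M * \<beta> ^ Suc k * (s ^ k / fact k))
        (at s within {0..1})"
      by (intro DERIV_add DERIV_sum DERIV_cmult DERIV_cmult_right pow DERIV_const)
    moreover have "(\<lambda>s. (\<Sum>i<k. s ^ Suc i / fact (Suc i) * (hop h a L ^^ Suc i) c n) + c n +
          M * \<beta> ^ Suc k * (s ^ Suc k / fact (Suc k))) = (\<lambda>s. P (Suc k) s n)"
      unfolding P_def sum.lessThan_Suc_shift by (simp add: power_mult_distrib mult_ac add_ac)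
    moreover have "(\<Sum>i<k. s ^ i / fact i * (hop h a L ^^ Suc i) c n) + 0 + M * \<beta> ^ Suc k * (s ^ k / fact k)
        = hop h a L (P k s) n"
      unfolding P_def hop_Taylor \<beta>_def[symmetric] by (simp add: power_mult_distrib mult_ac)
    ultimately show ?thesis by simp
  qed
  have step: "\<forall>s\<in>{0..1}. \<forall>n\<in>lattice_h h. cmod (w s n) \<le> P k s n" for k
  proof (induction k)
    case 0
    then show ?case using bd by (auto simp: P_def)
  next
    case (Suc k)
    show ?case
    proof (intro ballI)
      fix s and n :: "real^'d" assume s: "s \<in> {0..1::real}" and n: "n \<in> lattice_h h"
      have "cmod (w s n) \<le> cmod (w 0 n) + (P (Suc k) s n - P (Suc k) 0 n)"
      proof (rule norm_le_of_derivative[OF der[OF _ n] P' _ _ s])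
        fix r :: real assume r: "r \<in> {0..1}"
        have *: "hop h a L (\<lambda>m. cmod (w r m)) n \<le> hop h a L (P k r) n"
          using Suc.IH r by (intro hop_mono aL n) auto
        then show "Re (cnj (w r n) * w' r n) \<le> cmod (w r n) * hop h a L (P k r) n"
          using le[OF r n] by (meson mult_left_mono norm_ge_zero order_trans)
        have "0 \<le> hop h a L (\<lambda>m. cmod (w r m)) n"
          using hop_mono[OF aL, of h "\<lambda>_. 0" "\<lambda>m. cmod (w r m)" n] n by (simp add: hop_const)
        with * show "0 \<le> hop h a L (P k r) n" by simp
      qed auto
      moreover have "P (Suc k) 0 n = cmod (w 0 n)"
        unfolding P_def sum.lessThan_Suc_shift by (simp add: c_def)
      ultimately show "cmod (w s n) \<le> P (Suc k) s n" by simp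
    qed
  qed
  \<comment> \<open>All coefficients are nonnegative, so \<open>s\<close> may be replaced by 1; the
    resulting bound is uniform over the whole interval.\<close>
  have bound: "cmod (w s n) \<le> (\<Sum>i<k. (hop h a L ^^ i) c n / fact i) + M * (inverse (fact k) * \<beta> ^ k)" for k
  proof -
    have "P k s n \<le> P k 1 n"
      unfolding P_def using s \<beta> M hop_power_bounds(1)[OF aL c n]
      by (intro add_mono sum_mono mult_right_mono divide_right_mono mult_left_mono power_mono)
        (auto simp: power_le_one mult_left_le)
    with step[of k] s n show ?thesis
      by (force simp: P_def divide_inverse mult_ac)
  qed
  have "(\<lambda>k. (\<Sum>i<k. (hop h a L ^^ i) c n / fact i) + M * (inverse (fact k) * \<beta> ^ k))
      \<longlonglongrightarrow> hop_exp h a L c n + M * 0"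
    unfolding hop_exp_def
    using summable_LIMSEQ[OF summable_hop_exp[OF aL c n]] summable_LIMSEQ_zero[OF summable_exp[of \<beta>]]
    by (intro tendsto_add tendsto_mult tendsto_const) auto
  then show ?thesis
    unfolding c_def[symmetric] using bound by (intro LIMSEQ_le_const) auto
qed

text \<open>The substitution s = t r reduces both signs of \<open>t\<close> to the unit interval and
  puts the factor |t| into \<open>a\<close> and \<open>L\<close>; the absolute value in the
  differential inequality makes it insensitive to time reversal. One dominating function serves all
  \<open>s\<close> in the segment, which is later used for continuity in time.\<close>

lemma comparison:
  fixes w :: "real \<Rightarrow> real^'d \<Rightarrow> complex"
  assumes aL: "0 \<le> a" "0 \<le> L"
    and der: "\<And>s n. s \<in> closed_segment 0 t \<Longrightarrow> n \<in> lattice_h h \<Longrightarrow>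
        ((\<lambda>s. w s n) has_vector_derivative w' s n) (at s within closed_segment 0 t)"
    and le: "\<And>s n. s \<in> closed_segment 0 t \<Longrightarrow> n \<in> lattice_h h \<Longrightarrow>
        \<bar>Re (cnj (w s n) * w' s n)\<bar> \<le> cmod (w s n) * hop h a L (\<lambda>m. cmod (w s m)) n"
    and bd: "\<And>s n. s \<in> closed_segment 0 t \<Longrightarrow> n \<in> lattice_h h \<Longrightarrow> cmod (w s n) \<le> M"
    and s: "s \<in> closed_segment 0 t" and n: "n \<in> lattice_h h"
  shows "cmod (w s n) \<le> hop_exp h (a * \<bar>t\<bar>) (L * \<bar>t\<bar>) (\<lambda>m. cmod (w 0 m)) n"
proof -
  obtain r where r: "r \<in> {0..1}" "s = t * r"
    using s by (auto simp: in_segment mult.commute)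
  have seg: "t * r \<in> closed_segment 0 t" if "r \<in> {0..1}" for r
    using that by (auto simp: in_segment mult.commute intro!: exI[of _ r])
  have "cmod (w (t * r) n) \<le> hop_exp h (a * \<bar>t\<bar>) (L * \<bar>t\<bar>) (\<lambda>m. cmod (w (t * 0) m)) n"
  proof (rule comparison_unit_interval[where w = "\<lambda>r. w (t * r)" and w' = "\<lambda>r n. t *\<^sub>R w' (t * r) n"
        and M = M, OF _ _ _ _ _ r(1) n])
    fix r and m :: "real^'d" assume r: "r \<in> {0..1::real}" and m: "m \<in> lattice_h h"
    have "((\<lambda>r. t * r) has_vector_derivative t) (at r within {0..1})"
      by (auto intro!: derivative_eq_intros simp flip: has_real_derivative_iff_has_vector_derivative)
    from vector_diff_chain_within[OF this has_vector_derivative_within_subset[OF der[OF seg[OF r] m]]]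
    show "((\<lambda>r. w (t * r) m) has_vector_derivative t *\<^sub>R w' (t * r) m) (at r within {0..1})"
      using seg by (simp add: o_def image_subset_iff)
    have "Re (cnj (w (t * r) m) * (t *\<^sub>R w' (t * r) m)) = t * Re (cnj (w (t * r) m) * w' (t * r) m)"
      by (simp add: algebra_simps)
    also have "\<dots> \<le> \<bar>t\<bar> * \<bar>Re (cnj (w (t * r) m) * w' (t * r) m)\<bar>"
      by (metis abs_ge_self abs_mult)
    also have "\<dots> \<le> \<bar>t\<bar> * (cmod (w (t * r) m) * hop h a L (\<lambda>m. cmod (w (t * r) m)) m)"
      by (intro mult_left_mono le seg r m) auto
    also have "\<dots> = cmod (w (t * r) m) * hop h (a * \<bar>t\<bar>) (L * \<bar>t\<bar>) (\<lambda>m. cmod (w (t * r) m)) m"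
      by (simp add: hop_def algebra_simps)
    finally show "Re (cnj (w (t * r) m) * (t *\<^sub>R w' (t * r) m)) \<le> \<dots>" .
  qed (use aL bd seg in auto)
  then show ?thesis using r by simp
qed

subsection \<open>The comparison semigroup on $l^p_h$\<close>

lemma lp_le_hop:
  fixes c :: "real^'d \<Rightarrow> real"
  assumes "1 \<le> p" "0 \<le> a" "0 \<le> L" "lp_le h p C (\<lambda>n. of_real (c n))"
  shows "lp_le h p ((2 * real CARD('d) * a + L) * C) (\<lambda>n. of_real (hop h a L c n))"
proof -
  have "lp_le h p (\<Sum>j\<in>(UNIV::'d set). C + C) (\<lambda>n. \<Sum>j\<in>(UNIV::'d set).
      of_real (c (n + h *\<^sub>R axis j 1)) + of_real (c (n + - (h *\<^sub>R axis j 1))))"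
    by (intro lp_le_sum lp_le_add lp_le_shift[OF assms(1) assms(4)] assms(1)
        lattice_h_uminus lattice_h_axis)
  from lp_le_add[OF assms(1) lp_le_scaleR[OF assms(1) this, of a] lp_le_scaleR[OF assms(1,4), of L]]
  show ?thesis
    using assms(2,3) by (simp add: hop_def neighbour_sum_def scaleR_conv_of_real algebra_simps)
qed

lemma lp_le_hop_exp:
  fixes c :: "real^'d \<Rightarrow> real"
  assumes p: "1 \<le> p" and aL: "0 \<le> a" "0 \<le> L" and C: "lp_le h p C (\<lambda>n. of_real (c n))"
    and c: "\<And>n. 0 \<le> c n"
  shows "lp_le h p (exp (2 * real CARD('d) * a + L) * C) (\<lambda>n. of_real (hop_exp h a L c n))"
proof -
  define \<beta> where "\<beta> = 2 * real CARD('d) * a + L"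
  have \<beta>: "0 \<le> \<beta>" using aL by (simp add: \<beta>_def)
  have cb: "0 \<le> c m \<and> c m \<le> C" if "m \<in> lattice_h h" for m
    using lp_le_coord[OF p C that] c by simp
  have pow: "lp_le h p (\<beta> ^ k * C) (\<lambda>n. of_real ((hop h a L ^^ k) c n))" for k
  proof (induction k)
    case (Suc k)
    from lp_le_hop[OF p aL this] show ?case by (simp add: \<beta>_def mult.assoc)
  qed (simp add: C)
  have partial: "lp_le h p (exp \<beta> * C) (\<lambda>n. \<Sum>i<k. inverse (fact i) *\<^sub>R of_real ((hop h a L ^^ i) c n))" for k
  proof (rule lp_le_mono[OF p _ _ order_refl])
    show "lp_le h p (\<Sum>i<k. \<bar>inverse (fact i)\<bar> * (\<beta> ^ i * C))
        (\<lambda>n. \<Sum>i<k. inverse (fact i) *\<^sub>R of_real ((hop h a L ^^ i) c n))"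
      by (intro lp_le_sum lp_le_scaleR p pow)
    have "(\<Sum>i<k. \<beta> ^ i /\<^sub>R fact i) \<le> exp \<beta>"
      unfolding exp_def using \<beta> by (intro sum_le_suminf summable_exp_generic) auto
    then have "(\<Sum>i<k. \<beta> ^ i /\<^sub>R fact i) * C \<le> exp \<beta> * C"
      using lp_le_nonneg[OF C] by (rule mult_right_mono)
    then show "(\<Sum>i<k. \<bar>inverse (fact i)\<bar> * (\<beta> ^ i * C)) \<le> exp \<beta> * C"
      by (simp add: sum_distrib_right mult.assoc)
  qed
  show ?thesis
    unfolding \<beta>_def[symmetric]
  proof (rule lp_le_limit[OF p partial])
    fix n :: "real^'d" assume n: "n \<in> lattice_h h"
    have "(\<lambda>k. \<Sum>i<k. (hop h a L ^^ i) c n / fact i) \<longlonglongrightarrow> hop_exp h a L c n"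
      unfolding hop_exp_def by (rule summable_LIMSEQ[OF summable_hop_exp[OF aL cb n]])
    from tendsto_of_real[OF this]
    show "(\<lambda>k. \<Sum>i<k. inverse (fact i) *\<^sub>R complex_of_real ((hop h a L ^^ i) c n))
      \<longlonglongrightarrow> of_real (hop_exp h a L c n)"
      by (simp add: scaleR_conv_of_real divide_inverse mult.commute del: of_real_inverse)
  qed
qed

subsection \<open>The truncated nonlinearity and the vector field\<close>

text \<open>Only the amplitude inside the power is truncated, not \<open>z\<close> itself: the
  result is a real multiple of \<open>z\<close>, hence still a rotation in the equation.\<close>

definition cut :: "real \<Rightarrow> real \<Rightarrow> complex \<Rightarrow> complex" where
  "cut R \<sigma> z = of_real (min (cmod z) R powr (2 * \<sigma>)) * z"

lemma cut_0 [simp]: "cut R \<sigma> 0 = 0"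
  by (simp add: cut_def)

text \<open>The graph of a convex function lies above its tangent at \<open>b\<close>.\<close>

lemma powr_diff_le:
  fixes a b q :: real
  assumes "1 \<le> q" "0 \<le> a" "a \<le> b"
  shows "b powr q - a powr q \<le> q * b powr (q - 1) * (b - a)"
proof (cases "b = 0")
  case False
  then have b: "0 < b" using assms by simp
  have "((\<lambda>x. x powr q) has_real_derivative q * b powr (q - 1)) (at b within {0..})"
    using b by (auto intro!: derivative_eq_intros)
  then have "a powr q - b powr q \<ge> q * b powr (q - 1) * (a - b)"
    using assms b powr_convex_nonneg[OF assms(1)]
    by (intro convex_on_imp_above_tangent[where A = "{0..}"]) auto
  then show ?thesis by (simp add: algebra_simps)
qed (use assms in auto)

text \<open>For |z| \<le> |w| the difference splits into g(|w|)(z - w), contributing the constant 1,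
  and (g(|w|) - g(|z|)) z, contributing 2\<sigma> + 1; the sum is 2\<sigma> + 2.\<close>

lemma cut_lipschitz:
  assumes "0 < \<sigma>" "0 \<le> R"
  shows "cmod (cut R \<sigma> z - cut R \<sigma> w) \<le> (2 * \<sigma> + 2) * R powr (2 * \<sigma>) * cmod (z - w)"
proof -
  have *: "cmod (cut R \<sigma> z - cut R \<sigma> w) \<le> (2 * \<sigma> + 2) * R powr (2 * \<sigma>) * cmod (z - w)"
    if zw: "cmod z \<le> cmod w" for z w
  proof -
    define a b c where "a = cmod z" and "b = cmod w" and "c = min (cmod w) R"
    define g where "g r = min r R powr (2 * \<sigma>)" for r
    have gR: "g r \<le> R powr (2 * \<sigma>)" if "0 \<le> r" for r
      unfolding g_def using assms that by (intro powr_mono2) auto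
    have g0: "0 \<le> g r" for r by (simp add: g_def)
    have gab: "g a \<le> g b"
      unfolding g_def a_def b_def using assms zw by (intro powr_mono2) auto
    have ba: "b - a \<le> cmod (z - w)"
      unfolding a_def b_def by (metis norm_minus_commute norm_triangle_ineq2)
    \<comment> \<open>The power r^(2\<sigma>) alone need not be Lipschitz near 0 when 2\<sigma> < 1.
      The factor \<open>a\<close> raises the exponent to 2\<sigma> + 1, where the tangent inequality
      applies.\<close>
    have key: "(g b - g a) * a \<le> (2 * \<sigma> + 1) * R powr (2 * \<sigma>) * (b - a)"
    proof (cases "a < R")
      case True
      have ac: "0 \<le> a" "a \<le> c" "c \<le> R" "c \<le> b"
        using True zw by (auto simp: a_def b_def c_def)
      have ga: "g a = a powr (2 * \<sigma>)" and gb: "g b = c powr (2 * \<sigma>)"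
        using True by (auto simp: g_def b_def c_def)
      have "(g b - g a) * a \<le> g b * c - g a * a"
        using ac g0[of b] by (simp add: left_diff_distrib mult_left_mono)
      also have "\<dots> = c powr (2 * \<sigma> + 1) - a powr (2 * \<sigma> + 1)"
        using ac by (simp add: ga gb powr_add)
      also have "\<dots> \<le> (2 * \<sigma> + 1) * c powr (2 * \<sigma>) * (c - a)"
        using powr_diff_le[of "2 * \<sigma> + 1" a c] assms ac by simp
      also have "\<dots> \<le> (2 * \<sigma> + 1) * R powr (2 * \<sigma>) * (b - a)"
        using assms ac by (intro mult_mono powr_mono2) auto
      finally show ?thesis .
    next
      case False
      then have "g b - g a = 0"
        using zw by (simp add: g_def a_def b_def min_absorb2)
      then show ?thesis using assms zw by (simp add: a_def b_def)
    qed
    have "cut R \<sigma> z - cut R \<sigma> w = of_real (g b) * (z - w) - of_real (g b - g a) * z"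
      by (simp add: cut_def g_def a_def b_def algebra_simps)
    then have "cmod (cut R \<sigma> z - cut R \<sigma> w) \<le> cmod (of_real (g b) * (z - w)) + cmod (of_real (g b - g a) * z)"
      by (metis norm_triangle_ineq4)
    also have "\<dots> = g b * cmod (z - w) + (g b - g a) * a"
      using g0 gab by (simp add: norm_mult a_def del: of_real_diff)
    also have "\<dots> \<le> R powr (2 * \<sigma>) * cmod (z - w) + (2 * \<sigma> + 1) * R powr (2 * \<sigma>) * cmod (z - w)"
    proof (intro add_mono mult_right_mono gR)
      have "(2 * \<sigma> + 1) * R powr (2 * \<sigma>) * (b - a) \<le> (2 * \<sigma> + 1) * R powr (2 * \<sigma>) * cmod (z - w)"
        using ba assms by (intro mult_left_mono) auto
      with key show "(g b - g a) * a \<le> \<dots>" by simp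
    qed (auto simp: b_def)
    finally show ?thesis by (simp add: algebra_simps)
  qed
  show ?thesis
    using *[of z w] *[of w z] by (metis linear norm_minus_commute)
qed

text \<open>The equation solved for u'. The nonlinearity is a parameter so that the original and the
  truncated problem share all estimates.\<close>

definition dnls_field ::
    "real \<Rightarrow> (real^'d \<Rightarrow> real) \<Rightarrow> real \<Rightarrow> (complex \<Rightarrow> complex) \<Rightarrow> (real^'d \<Rightarrow> complex) \<Rightarrow> real^'d \<Rightarrow> complex"
  where "dnls_field h V lam f u n =
    - \<i> * (laplacian_h h u n - of_real (V n) * u n - of_real lam * f (u n))"

lemma laplacian_h_eq:
  fixes u :: "real^'d \<Rightarrow> complex"
  shows "laplacian_h h u n =
    of_real (1 / h\<^sup>2) * neighbour_sum h u n - of_real (2 * real CARD('d) / h\<^sup>2) * u n"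
proof -
  have "laplacian_h h u n = of_real (1 / h\<^sup>2) * (neighbour_sum h u n - (\<Sum>j\<in>(UNIV::'d set). 2 * u n))"
    unfolding laplacian_h_def neighbour_sum_def sum_subtractf [symmetric] scaleR_conv_of_real
    by (rule sum_distrib_left [symmetric])
  then show ?thesis by (simp add: algebra_simps)
qed

lemma dnls_equation_iff:
  "dnls_equation h V lam \<sigma> I u \<longleftrightarrow> (\<forall>t\<in>I. \<forall>n\<in>lattice_h h. ((\<lambda>s. u s n) has_vector_derivative
     dnls_field h V lam (\<lambda>z. of_real (cmod z powr (2 * \<sigma>)) * z) (u t) n) (at t within I))"
proof -
  have "\<i> * d - X + v + w = 0 \<longleftrightarrow> d = - \<i> * (X - v - w)" for d X v w
    by (simp add: complex_eq_iff) linarith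
  then show ?thesis
    by (simp add: dnls_equation_def dnls_field_def mult.assoc)
qed

lemma dnls_field_cut:
  assumes "cmod (u n) \<le> R"
  shows "dnls_field h V lam (cut R \<sigma>) u n =
    dnls_field h V lam (\<lambda>z. of_real (cmod z powr (2 * \<sigma>)) * z) u n"
  using assms by (simp add: dnls_field_def cut_def min_absorb1)

text \<open>The term i \<theta> z with real \<theta> is orthogonal to \<open>z\<close> in the plane,
  so it drops out of the derivative of |z|^2.\<close>

lemma abs_Re_cnj_mult_le:
  assumes "D = X + of_real \<theta> * (\<i> * z)" "cmod X \<le> B"
  shows "\<bar>Re (cnj z * D)\<bar> \<le> cmod z * B"
proof -
  have "Re (cnj z * D) = Re (cnj z * X)"
    unfolding assms(1) by (simp add: algebra_simps)
  then have "\<bar>Re (cnj z * D)\<bar> \<le> cmod z * cmod X"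
    by (metis abs_Re_le_cmod complex_mod_cnj norm_mult)
  also have "\<dots> \<le> cmod z * B"
    using assms(2) by (simp add: mult_left_mono)
  finally show ?thesis .
qed

text \<open>All diagonal terms with a real coefficient rotate $u_n$ without changing its modulus, so only
  the neighbours contribute; this is what produces the constant $2d/h^2$.\<close>

lemma dnls_field_growth:
  fixes u :: "real^'d \<Rightarrow> complex"
  shows "\<bar>Re (cnj (u n) * dnls_field h V lam (\<lambda>z. of_real (\<phi> z) * z) u n)\<bar>
    \<le> cmod (u n) * hop h (1 / h\<^sup>2) 0 (\<lambda>m. cmod (u m)) n"
proof (rule abs_Re_cnj_mult_le)
  show "dnls_field h V lam (\<lambda>z. of_real (\<phi> z) * z) u n = - \<i> * of_real (1 / h\<^sup>2) * neighbour_sum h u n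
      + of_real (2 * real CARD('d) / h\<^sup>2 + V n + lam * \<phi> (u n)) * (\<i> * u n)"
    unfolding dnls_field_def laplacian_h_eq by (simp add: algebra_simps)
  show "cmod (- \<i> * of_real (1 / h\<^sup>2) * neighbour_sum h u n) \<le> hop h (1 / h\<^sup>2) 0 (\<lambda>m. cmod (u m)) n"
    using norm_neighbour_sum_le[of h u n]
    by (simp add: norm_mult norm_divide norm_power hop_def divide_right_mono)
qed

text \<open>The linear diagonal still rotates u - v. The difference of the nonlinear terms need not
  be a rotation of u - v, so it joins the neighbours and is paid for by a Lipschitz
  constant.\<close>

lemma dnls_field_diff:
  fixes u v :: "real^'d \<Rightarrow> complex"
  shows "dnls_field h V lam f u n - dnls_field h V lam f v n =
    (- \<i> * of_real (1 / h\<^sup>2) * neighbour_sum h (\<lambda>m. u m - v m) n + \<i> * of_real lam * (f (u n) - f (v n)))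
    + of_real (2 * real CARD('d) / h\<^sup>2 + V n) * (\<i> * (u n - v n))"
proof -
  have *: "- \<i> * (\<alpha> * M - \<beta> * x - \<gamma> * x - \<mu> * y) - - \<i> * (\<alpha> * N - \<beta> * z - \<gamma> * z - \<mu> * r) =
      (- \<i> * \<alpha> * (M - N) + \<i> * \<mu> * (y - r)) + (\<beta> + \<gamma>) * (\<i> * (x - z))"
    for \<alpha> \<beta> \<gamma> \<mu> M N x y z r :: complex
    by (simp add: algebra_simps)
  show ?thesis
    unfolding dnls_field_def laplacian_h_eq neighbour_sum_diff of_real_add by (rule *)
qed

lemma norm_off_diagonal_le:
  fixes u v :: "real^'d \<Rightarrow> complex"
  assumes "\<bar>lam\<bar> \<le> 1" "\<And>z w. cmod (f z - f w) \<le> L * cmod (z - w)"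
  shows "cmod (- \<i> * of_real (1 / h\<^sup>2) * neighbour_sum h (\<lambda>m. u m - v m) n
      + \<i> * of_real lam * (f (u n) - f (v n)))
    \<le> hop h (1 / h\<^sup>2) L (\<lambda>m. cmod (u m - v m)) n"
proof -
  have "cmod (\<i> * of_real lam * (f (u n) - f (v n))) \<le> 1 * cmod (f (u n) - f (v n))"
    using assms(1) by (simp add: norm_mult mult_left_le_one_le)
  also have "\<dots> \<le> L * cmod (u n - v n)"
    using assms(2) by simp
  finally have *: "cmod (\<i> * of_real lam * (f (u n) - f (v n))) \<le> L * cmod (u n - v n)" .
  have "cmod (- \<i> * of_real (1 / h\<^sup>2) * neighbour_sum h (\<lambda>m. u m - v m) n)
      \<le> 1 / h\<^sup>2 * neighbour_sum h (\<lambda>m. cmod (u m - v m)) n"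
    using norm_neighbour_sum_le[of h "\<lambda>m. u m - v m" n]
    by (simp add: norm_mult norm_divide norm_power divide_right_mono)
  with * show ?thesis
    unfolding hop_def by (intro norm_triangle_mono)
qed

lemma dnls_field_diff_growth:
  fixes u v :: "real^'d \<Rightarrow> complex"
  assumes "\<bar>lam\<bar> \<le> 1" "\<And>z w. cmod (f z - f w) \<le> L * cmod (z - w)"
  shows "\<bar>Re (cnj (u n - v n) * (dnls_field h V lam f u n - dnls_field h V lam f v n))\<bar>
    \<le> cmod (u n - v n) * hop h (1 / h\<^sup>2) L (\<lambda>m. cmod (u m - v m)) n"
  by (rule abs_Re_cnj_mult_le[OF dnls_field_diff norm_off_diagonal_le[OF assms]])

text \<open>Here the full modulus of the field is estimated, so nothing cancels and the diagonal
  contributes 2d/h^2 + B. This serves existence and continuity in time; the growth rate relies on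
  the cancellation instead.\<close>

lemma norm_dnls_field_diff_le:
  fixes u v :: "real^'d \<Rightarrow> complex"
  assumes "\<bar>lam\<bar> \<le> 1" "\<And>z w. cmod (f z - f w) \<le> L * cmod (z - w)" "\<bar>V n\<bar> \<le> B"
  shows "cmod (dnls_field h V lam f u n - dnls_field h V lam f v n)
    \<le> hop h (1 / h\<^sup>2) (2 * real CARD('d) / h\<^sup>2 + B + L) (\<lambda>m. cmod (u m - v m)) n"
proof -
  have *: "\<bar>2 * real CARD('d) / h\<^sup>2 + V n\<bar> \<le> 2 * real CARD('d) / h\<^sup>2 + B"
    using assms(3) abs_triangle_ineq[of "2 * real CARD('d) / h\<^sup>2" "V n"] by simp
  have "cmod (of_real (2 * real CARD('d) / h\<^sup>2 + V n) * (\<i> * (u n - v n)))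
      = \<bar>2 * real CARD('d) / h\<^sup>2 + V n\<bar> * cmod (u n - v n)"
    by (simp only: norm_mult norm_of_real norm_ii mult_1)
  also have "\<dots> \<le> (2 * real CARD('d) / h\<^sup>2 + B) * cmod (u n - v n)"
    by (intro mult_right_mono *) simp
  finally have "cmod (dnls_field h V lam f u n - dnls_field h V lam f v n)
    \<le> hop h (1 / h\<^sup>2) L (\<lambda>m. cmod (u m - v m)) n + \<dots>"
    unfolding dnls_field_diff by (intro norm_triangle_mono norm_off_diagonal_le assms)
  then show ?thesis by (simp add: hop_def algebra_simps)
qed

subsection \<open>Picard iteration for infinite systems\<close>

text \<open>The signed integral from 0 to t: of the two interval integrals, the one with reversed
  endpoints is 0.\<close>

definition primitive :: "(real \<Rightarrow> 'b::banach) \<Rightarrow> real \<Rightarrow> 'b" where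
  "primitive f t = integral {0..t} f - integral {t..0} f"

lemma primitive_0 [simp]: "primitive f 0 = 0"
  by (simp add: primitive_def)

lemma has_vector_derivative_primitive:
  fixes f :: "real \<Rightarrow> 'b::banach"
  assumes "continuous_on UNIV f"
  shows "(primitive f has_vector_derivative f t) (at t)"
proof -
  define T where "T = \<bar>t\<bar> + 1"
  have t: "- T < t" "t < T" and T: "0 < T" by (auto simp: T_def)
  have int: "f integrable_on {a..b}" for a b
    by (intro integrable_continuous_real continuous_on_subset[OF assms]) auto
  have eq: "integral {-T..s} f - integral {-T..0} f = primitive f s" if "s \<in> {-T<..<T}" for s
  proof (cases "0 \<le> s")
    case True
    have "integral {s..0} f = 0"
      using True by (cases "s = 0") auto
    then show ?thesis
      using Henstock_Kurzweil_Integration.integral_combine[OF _ True int, of "- T"] T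
      by (simp add: primitive_def algebra_simps)
  next
    case False
    then show ?thesis
      using Henstock_Kurzweil_Integration.integral_combine[OF _ _ int, of "- T" s 0] that
      by (simp add: primitive_def algebra_simps)
  qed
  have "((\<lambda>s. integral {-T..s} f) has_vector_derivative f t) (at t within {-T..T})"
    using t by (intro integral_has_vector_derivative continuous_on_subset[OF assms]) auto
  then have "((\<lambda>s. integral {-T..s} f - integral {-T..0} f) has_vector_derivative f t - 0) (at t)"
    using t by (intro has_vector_derivative_diff has_vector_derivative_const) (simp add: at_within_Icc_at)
  then have "((\<lambda>s. integral {-T..s} f - integral {-T..0} f) has_vector_derivative f t) (at t)" by simp
  then show ?thesis
    by (rule has_vector_derivative_transform_within_open[where S = "{-T<..<T}"]) (use t eq in auto)
qed

text \<open>One integration of a power bound; the divisors k + 1 accumulate to the factorial in the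
  Picard estimate. Negative times follow by reflection.\<close>

lemma norm_increment_le_abs_power:
  fixes x :: "real \<Rightarrow> 'b::real_normed_vector"
  assumes der: "\<And>s. (x has_vector_derivative x' s) (at s)"
    and bound: "\<And>s. \<bar>s\<bar> \<le> \<bar>t\<bar> \<Longrightarrow> norm (x' s) \<le> C * \<bar>s\<bar> ^ k"
  shows "norm (x t - x 0) \<le> C * (\<bar>t\<bar> ^ Suc k / real (Suc k))"
proof -
  have forward: "norm (y t - y 0) \<le> C * (t ^ Suc k / real (Suc k))"
    if "0 < t" and d: "\<And>s. (y has_vector_derivative y' s) (at s)"
      and b: "\<And>s. 0 < s \<Longrightarrow> s < t \<Longrightarrow> norm (y' s) \<le> C * s ^ k" for t and y y' :: "real \<Rightarrow> 'b"
  proof -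
    have \<phi>: "((\<lambda>s. C * (s ^ Suc k / real (Suc k))) has_vector_derivative C * s ^ k) (at s)" for s
      unfolding has_real_derivative_iff_has_vector_derivative[symmetric]
      by (rule derivative_eq_intros refl | simp del: of_nat_Suc)+
    have "norm (y t - y 0) \<le> C * (t ^ Suc k / real (Suc k)) - C * (0 ^ Suc k / real (Suc k))"
      using that(1) d \<phi> b
      by (intro differentiable_bound_general[where \<phi> = "\<lambda>s. C * (s ^ Suc k / real (Suc k))"]
          continuous_at_imp_continuous_on) (auto intro: has_vector_derivative_continuous)
    then show ?thesis by simp
  qed
  consider "t = 0" | "0 < t" | "t < 0" by linarith
  then show ?thesis
  proof cases
    case 2
    have "norm (x' s) \<le> C * s ^ k" if "0 < s" "s < t" for s
      using bound[of s] that by simp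
    from forward[of t x x', OF 2 der this] 2 show ?thesis by simp
  next
    case 3
    have "((\<lambda>s. x (- s)) has_vector_derivative - x' (- s)) (at s)" for s
    proof -
      have "(uminus has_vector_derivative - 1) (at s)"
        by (auto intro!: derivative_eq_intros)
      from vector_diff_chain_at[OF this der] show ?thesis by (simp add: o_def)
    qed
    moreover have "norm (- x' (- s)) \<le> C * s ^ k" if "0 < s" "s < - t" for s
      using bound[of "- s"] that by simp
    ultimately show ?thesis
      using forward[of "- t" "\<lambda>s. x (- s)" "\<lambda>s. - x' (- s)"] 3 by simp
  qed simp
qed

lemma has_vector_derivative_limit:
  fixes f :: "nat \<Rightarrow> real \<Rightarrow> 'b::banach"
  assumes der: "\<And>k s. (f k has_vector_derivative f' k s) (at s)"
    and unif: "uniform_limit {t - 1<..<t + 1} f' g' sequentially"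
    and lim: "\<And>s. s \<in> {t - 1<..<t + 1} \<Longrightarrow> (\<lambda>k. f k s) \<longlonglongrightarrow> g s"
  shows "(g has_vector_derivative g' t) (at t)"
proof -
  let ?S = "{t - 1<..<t + 1}"
  have "\<exists>G. \<forall>s\<in>?S. (\<lambda>k. f k s) \<longlonglongrightarrow> G s \<and> (G has_derivative (\<lambda>h::real. h *\<^sub>R g' s)) (at s within ?S)"
  proof (rule has_derivative_sequence)
    show "(f k has_derivative (\<lambda>h::real. h *\<^sub>R f' k s)) (at s within ?S)" for k s
      using der[of k s] has_vector_derivative_at_within has_vector_derivative_def by blast
    fix e :: real assume "0 < e"
    from uniform_limitD[OF unif this]
    show "\<forall>\<^sub>F k in sequentially. \<forall>s\<in>?S. \<forall>h::real. norm (h *\<^sub>R f' k s - h *\<^sub>R g' s) \<le> e * norm h"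
    proof eventually_elim
      case (elim k)
      show ?case
      proof (intro ballI allI)
        fix s h :: real assume "s \<in> ?S"
        then have "norm (f' k s - g' s) \<le> e" using elim by (auto simp: dist_norm less_imp_le)
        then have "norm h * norm (f' k s - g' s) \<le> norm h * e"
          by (intro mult_left_mono) auto
        then show "norm (h *\<^sub>R f' k s - h *\<^sub>R g' s) \<le> e * norm h"
          by (simp add: mult.commute flip: scaleR_diff_right)
      qed
    qed
  qed (use lim[of t] in auto)
  then obtain G where G: "\<And>s. s \<in> ?S \<Longrightarrow> (\<lambda>k. f k s) \<longlonglongrightarrow> G s"
    "(G has_derivative (\<lambda>h::real. h *\<^sub>R g' t)) (at t within ?S)" by force
  have "(G has_vector_derivative g' t) (at t)"
    using G(2) by (simp add: has_vector_derivative_def at_within_open[of t ?S])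
  then show ?thesis
    by (rule has_vector_derivative_transform_within_open[where S = ?S])
      (auto intro: LIMSEQ_unique[OF G(1) lim])
qed

text \<open>Supremum-norm Picard iteration, with the norm expressed by uniform bounds \<delta> over
  \<open>X\<close> and continuity asked only of each component. The Lipschitz constant on a time
  interval is global in the unknown, so the factorial gain makes the iteration converge for all
  times. The last conclusion supplies the crude bound that the comparison needs.\<close>

lemma picard_infinite_system:
  fixes F :: "real \<Rightarrow> ('n \<Rightarrow> 'b::banach) \<Rightarrow> 'n \<Rightarrow> 'b"
  assumes lipschitz: "\<And>T. \<exists>\<Lambda>\<ge>0. \<forall>t v w \<delta>. \<bar>t\<bar> \<le> T \<longrightarrow> (\<forall>n\<in>X. norm (v n - w n) \<le> \<delta>) \<longrightarrow>
        (\<forall>n\<in>X. norm (F t v n - F t w n) \<le> \<Lambda> * \<delta>)"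
    and bounded: "\<And>T. \<exists>K. \<forall>t. \<bar>t\<bar> \<le> T \<longrightarrow> (\<forall>n\<in>X. norm (F t u0 n) \<le> K)"
    and cont: "\<And>v n. n \<in> X \<Longrightarrow> (\<And>m. m \<in> X \<Longrightarrow> continuous_on UNIV (\<lambda>t. v t m)) \<Longrightarrow>
        continuous_on UNIV (\<lambda>t. F t (v t) n)"
  obtains u where "\<And>n. n \<in> X \<Longrightarrow> u 0 n = u0 n"
    and "\<And>n t. n \<in> X \<Longrightarrow> ((\<lambda>t. u t n) has_vector_derivative F t (u t) n) (at t)"
    and "\<And>T. \<exists>M. \<forall>t. \<bar>t\<bar> \<le> T \<longrightarrow> (\<forall>n\<in>X. norm (u t n - u0 n) \<le> M)"
proof -
  define U where "U = rec_nat (\<lambda>t. u0) (\<lambda>k v t n. u0 n + primitive (\<lambda>s. F s (v s) n) t)"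
  have U0: "U 0 t n = u0 n" and US: "U (Suc k) t n = u0 n + primitive (\<lambda>s. F s (U k s) n) t" for k t n
    by (auto simp: U_def)
  have U_der: "((\<lambda>t. U (Suc k) t n) has_vector_derivative F t (U k t) n) (at t)"
    if c: "\<And>m. m \<in> X \<Longrightarrow> continuous_on UNIV (\<lambda>t. U k t m)" and n: "n \<in> X" for k t n
    unfolding US using has_vector_derivative_primitive[OF cont[where v = "U k", OF n c], of t]
    by (auto intro!: derivative_eq_intros)
  have U_cont: "continuous_on UNIV (\<lambda>t. U k t n)" if "n \<in> X" for k n
    using that
  proof (induction k arbitrary: n)
    case (Suc k)
    show ?case
      using U_der[OF Suc.IH Suc.prems]
      by (intro continuous_at_imp_continuous_on) (blast intro: has_vector_derivative_continuous)
  qed (simp add: U0)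
  have U_der: "((\<lambda>t. U (Suc k) t n) has_vector_derivative F t (U k t) n) (at t)" if "n \<in> X" for k t n
    by (rule U_der[OF U_cont that])
  define u where "u t n = u0 n + (\<Sum>k. U (Suc k) t n - U k t n)" for t n
  have partial: "U k t n - u0 n = (\<Sum>i<k. U (Suc i) t n - U i t n)" for k t n
    using sum_lessThan_telescope[of "\<lambda>i. U i t n" k] by (simp add: U0)
  have conv: "\<exists>M. summable M \<and> (\<forall>k t n. \<bar>t\<bar> \<le> T \<longrightarrow> n \<in> X \<longrightarrow> norm (U (Suc k) t n - U k t n) \<le> M k)"
    if T: "0 \<le> T" for T
  proof -
    obtain \<Lambda> where \<Lambda>: "0 \<le> \<Lambda>" and
      lip: "\<And>t v w \<delta> n. \<bar>t\<bar> \<le> T \<Longrightarrow> (\<And>n. n \<in> X \<Longrightarrow> norm (v n - w n) \<le> \<delta>) \<Longrightarrow> n \<in> X \<Longrightarrow>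
        norm (F t v n - F t w n) \<le> \<Lambda> * \<delta>"
      using lipschitz[of T] by meson
    obtain K where K: "\<And>t n. \<bar>t\<bar> \<le> T \<Longrightarrow> n \<in> X \<Longrightarrow> norm (F t u0 n) \<le> K"
      using bounded[of T] by meson
    \<comment> \<open>In total K \<Lambda>^k |t|^(k+1)/(k+1)!: each iteration contributes one factor
      \<Lambda> and one integration.\<close>
    have bd: "norm (U (Suc k) t n - U k t n) \<le> K * \<Lambda> ^ k / fact k * (\<bar>t\<bar> ^ Suc k / real (Suc k))"
      if "\<bar>t\<bar> \<le> T" "n \<in> X" for k t n
      using that
    proof (induction k arbitrary: t n)
      case 0
      have "norm (U (Suc 0) t n - U (Suc 0) 0 n) \<le> K * (\<bar>t\<bar> ^ Suc 0 / real (Suc 0))"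
        using U_der[OF \<open>n \<in> X\<close>, of 0] 0 K
        by (intro norm_increment_le_abs_power) (auto simp: U0[abs_def])
      then show ?case by (simp add: U0 US)
    next
      case (Suc k)
      have "norm ((U (Suc (Suc k)) t n - U (Suc k) t n) - (U (Suc (Suc k)) 0 n - U (Suc k) 0 n))
        \<le> K * \<Lambda> ^ Suc k / fact (Suc k) * (\<bar>t\<bar> ^ Suc (Suc k) / real (Suc (Suc k)))"
      proof (rule norm_increment_le_abs_power)
        show "((\<lambda>t. U (Suc (Suc k)) t n - U (Suc k) t n) has_vector_derivative
            F s (U (Suc k) s) n - F s (U k s) n) (at s)" for s
          by (intro has_vector_derivative_diff U_der Suc.prems)
        fix s assume "\<bar>s\<bar> \<le> \<bar>t\<bar>"
        then have s: "\<bar>s\<bar> \<le> T" using Suc.prems by simp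
        from lip[OF s Suc.IH[OF s] Suc.prems(2)]
        show "norm (F s (U (Suc k) s) n - F s (U k s) n) \<le> K * \<Lambda> ^ Suc k / fact (Suc k) * \<bar>s\<bar> ^ Suc k"
          by (simp add: mult_ac)
      qed
      then show ?case by (simp add: US)
    qed
    have "summable (\<lambda>k. \<bar>K\<bar> * T * (inverse (fact k) * (\<Lambda> * T) ^ k))"
      by (intro summable_mult summable_exp)
    moreover have "norm (U (Suc k) t n - U k t n) \<le> \<bar>K\<bar> * T * (inverse (fact k) * (\<Lambda> * T) ^ k)"
      if "\<bar>t\<bar> \<le> T" "n \<in> X" for k t n
    proof -
      have "\<bar>t\<bar> ^ Suc k / real (Suc k) \<le> \<bar>t\<bar> ^ Suc k / 1"
        by (intro divide_left_mono) auto
      also have "\<dots> \<le> T ^ Suc k"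
        using that by (simp add: power_mono del: power_Suc)
      finally have *: "\<bar>t\<bar> ^ Suc k / real (Suc k) \<le> T ^ Suc k" .
      have "norm (U (Suc k) t n - U k t n) \<le> K * \<Lambda> ^ k / fact k * (\<bar>t\<bar> ^ Suc k / real (Suc k))"
        by (rule bd[OF that])
      also have "\<dots> \<le> \<bar>K\<bar> * \<Lambda> ^ k / fact k * T ^ Suc k"
        using * \<Lambda> T by (intro mult_mono divide_right_mono mult_right_mono) auto
      finally show ?thesis by (simp add: divide_inverse power_mult_distrib mult_ac)
    qed
    ultimately show ?thesis by blast
  qed
  have unif: "\<forall>\<^sub>F k in sequentially. \<forall>t n. \<bar>t\<bar> \<le> T \<longrightarrow> n \<in> X \<longrightarrow> norm (U k t n - u t n) < e"
    if T: "0 \<le> T" and e: "0 < e" for T e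
  proof -
    obtain M where M: "summable M"
      "\<And>k t n. \<bar>t\<bar> \<le> T \<Longrightarrow> n \<in> X \<Longrightarrow> norm (U (Suc k) t n - U k t n) \<le> M k"
      using conv[OF T] by blast
    \<comment> \<open>Uniformity over sites as well as times is essential, since the Lipschitz
      hypothesis compares all components at once.\<close>
    have "uniform_limit ({-T..T} \<times> X) (\<lambda>k x. \<Sum>i<k. U (Suc i) (fst x) (snd x) - U i (fst x) (snd x))
        (\<lambda>x. \<Sum>i. U (Suc i) (fst x) (snd x) - U i (fst x) (snd x)) sequentially"
      by (rule Weierstrass_m_test[OF _ M(1)]) (auto intro!: M(2))
    from uniform_limitD[OF this e] show ?thesis
    proof eventually_elim
      case (elim k)
      show ?case
      proof (intro allI impI)
        fix t n assume "\<bar>t\<bar> \<le> T" "n \<in> X"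
        then have "(t, n) \<in> {-T..T} \<times> X" by auto
        from bspec[OF elim this] have "norm ((U k t n - u0 n) - (\<Sum>i. U (Suc i) t n - U i t n)) < e"
          by (simp only: dist_norm fst_conv snd_conv partial)
        then show "norm (U k t n - u t n) < e" by (simp only: u_def diff_diff_eq)
      qed
    qed
  qed
  show thesis
  proof
    show "u 0 n = u0 n" if "n \<in> X" for n
    proof -
      have "U k 0 n = u0 n" for k by (cases k) (auto simp: U0 US)
      then show ?thesis by (simp add: u_def)
    qed
    show "((\<lambda>t. u t n) has_vector_derivative F t (u t) n) (at t)" if n: "n \<in> X" for n t
    proof (rule has_vector_derivative_limit[where g' = "\<lambda>t. F t (u t) n"
          and f = "\<lambda>k t. U (Suc k) t n" and f' = "\<lambda>k t. F t (U k t) n"])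
      define T where "T = \<bar>t\<bar> + 1"
      have T: "0 \<le> T" by (simp add: T_def)
      show "((\<lambda>t. U (Suc k) t n) has_vector_derivative F s (U k s) n) (at s)" for k s
        by (rule U_der[OF n])
      obtain \<Lambda> where \<Lambda>: "0 \<le> \<Lambda>" and
        lip: "\<And>t v w \<delta> n. \<bar>t\<bar> \<le> T \<Longrightarrow> (\<And>n. n \<in> X \<Longrightarrow> norm (v n - w n) \<le> \<delta>) \<Longrightarrow> n \<in> X \<Longrightarrow>
          norm (F t v n - F t w n) \<le> \<Lambda> * \<delta>"
        using lipschitz[of T] by meson
      show "uniform_limit {t - 1<..<t + 1} (\<lambda>k t. F t (U k t) n) (\<lambda>t. F t (u t) n) sequentially"
      proof (rule uniform_limitI)
        fix e :: real assume e: "0 < e"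
        \<comment> \<open>The added 1 covers \<Lambda> = 0 and makes the final inequality
          strict.\<close>
        define \<delta> where "\<delta> = e / (\<Lambda> + 1)"
        have \<delta>: "0 < \<delta>" "\<Lambda> * \<delta> < e" using e \<Lambda> by (auto simp: \<delta>_def field_simps)
        from unif[OF T \<delta>(1)]
        show "\<forall>\<^sub>F k in sequentially. \<forall>s\<in>{t - 1<..<t + 1}. dist (F s (U k s) n) (F s (u s) n) < e"
        proof eventually_elim
          case (elim k)
          show ?case
          proof
            fix s assume "s \<in> {t - 1<..<t + 1}"
            then have s: "\<bar>s\<bar> \<le> T" by (auto simp: T_def)
            have "norm (F s (U k s) n - F s (u s) n) \<le> \<Lambda> * \<delta>"
              using elim s by (intro lip[OF s _ n]) (auto simp: less_imp_le)
            with \<delta> show "dist (F s (U k s) n) (F s (u s) n) < e" by (simp add: dist_norm)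
          qed
        qed
      qed
      show "(\<lambda>k. U (Suc k) s n) \<longlonglongrightarrow> u s n" if "s \<in> {t - 1<..<t + 1}" for s
      proof (rule LIMSEQ_Suc, rule tendstoI)
        fix e :: real assume "0 < e"
        from unif[OF T this] show "\<forall>\<^sub>F k in sequentially. dist (U k s n) (u s n) < e"
          by (rule eventually_mono) (use that n in \<open>auto simp: dist_norm T_def\<close>)
      qed
    qed
    show "\<exists>M. \<forall>t. \<bar>t\<bar> \<le> T \<longrightarrow> (\<forall>n\<in>X. norm (u t n - u0 n) \<le> M)" for T
    proof -
      obtain M where M: "summable M"
        "\<And>k t n. \<bar>t\<bar> \<le> \<bar>T\<bar> \<Longrightarrow> n \<in> X \<Longrightarrow> norm (U (Suc k) t n - U k t n) \<le> M k"
        using conv[of "\<bar>T\<bar>"] by auto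
      have "norm (u t n - u0 n) \<le> suminf M" if "\<bar>t\<bar> \<le> T" "n \<in> X" for t n
        using that M by (auto simp: u_def intro!: norm_suminf_le)
      then show ?thesis by blast
    qed
  qed
qed

subsection \<open>Estimates for solutions\<close>

text \<open>Both solutions stay below \<open>R\<close>, so they also solve the equation truncated at
  \<open>R\<close>, whose nonlinearity is globally Lipschitz.\<close>

lemma hop_exp_on_segment:
  fixes u v :: "real \<Rightarrow> real^'d \<Rightarrow> complex"
  assumes \<sigma>: "0 < \<sigma>" and lam: "\<bar>lam\<bar> \<le> 1" and R: "0 \<le> R"
    and seg: "closed_segment 0 t \<subseteq> I"
    and u: "dnls_equation h V lam \<sigma> I u" and v: "dnls_equation h V lam \<sigma> I v"
    and bu: "\<And>s n. s \<in> closed_segment 0 t \<Longrightarrow> n \<in> lattice_h h \<Longrightarrow> cmod (u s n) \<le> R"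
    and bv: "\<And>s n. s \<in> closed_segment 0 t \<Longrightarrow> n \<in> lattice_h h \<Longrightarrow> cmod (v s n) \<le> R"
    and s: "s \<in> closed_segment 0 t" and n: "n \<in> lattice_h h"
  shows "cmod (u s n - v s n) \<le> hop_exp h (1 / h\<^sup>2 * \<bar>t\<bar>) ((2 * \<sigma> + 2) * R powr (2 * \<sigma>) * \<bar>t\<bar>)
    (\<lambda>m. cmod (u 0 m - v 0 m)) n"
proof (rule comparison[where M = "R + R" and
      w' = "\<lambda>s n. dnls_field h V lam (cut R \<sigma>) (u s) n - dnls_field h V lam (cut R \<sigma>) (v s) n", OF _ _ _ _ _ s n])
  fix r and m :: "real^'d" assume r: "r \<in> closed_segment 0 t" and m: "m \<in> lattice_h h"
  show "((\<lambda>s. u s m - v s m) has_vector_derivative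
      dnls_field h V lam (cut R \<sigma>) (u r) m - dnls_field h V lam (cut R \<sigma>) (v r) m)
      (at r within closed_segment 0 t)"
    unfolding dnls_field_cut[of "u r" m, OF bu[OF r m]] dnls_field_cut[of "v r" m, OF bv[OF r m]]
    using u v seg r m unfolding dnls_equation_iff
    by (intro has_vector_derivative_diff)
      (meson has_vector_derivative_within_subset subsetD)+
  show "\<bar>Re (cnj (u r m - v r m) *
      (dnls_field h V lam (cut R \<sigma>) (u r) m - dnls_field h V lam (cut R \<sigma>) (v r) m))\<bar>
    \<le> cmod (u r m - v r m) * hop h (1 / h\<^sup>2) ((2 * \<sigma> + 2) * R powr (2 * \<sigma>)) (\<lambda>m. cmod (u r m - v r m)) m"
    by (rule dnls_field_diff_growth[OF lam cut_lipschitz[OF \<sigma> R]])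
  show "cmod (u r m - v r m) \<le> R + R"
    using bu[OF r m] bv[OF r m] norm_triangle_le_diff by (metis add_mono norm_triangle_ineq4 order_trans)
qed (use \<sigma> in auto)

lemma lp_le_dnls_diff:
  fixes u v :: "real \<Rightarrow> real^'d \<Rightarrow> complex"
  assumes \<sigma>: "0 < \<sigma>" and lam: "\<bar>lam\<bar> \<le> 1" and R: "0 \<le> R" and p: "1 \<le> p"
    and seg: "closed_segment 0 t \<subseteq> I"
    and u: "dnls_equation h V lam \<sigma> I u" and v: "dnls_equation h V lam \<sigma> I v"
    and bu: "\<And>s n. s \<in> closed_segment 0 t \<Longrightarrow> n \<in> lattice_h h \<Longrightarrow> cmod (u s n) \<le> R"
    and bv: "\<And>s n. s \<in> closed_segment 0 t \<Longrightarrow> n \<in> lattice_h h \<Longrightarrow> cmod (v s n) \<le> R"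
    and C: "lp_le h p C (\<lambda>n. u 0 n - v 0 n)"
  shows "lp_le h p (exp ((2 * real CARD('d) / h\<^sup>2 + (2 * \<sigma> + 2) * R powr (2 * \<sigma>)) * \<bar>t\<bar>) * C)
    (\<lambda>n. u t n - v t n)"
proof (rule lp_le_mono[OF p])
  let ?c = "\<lambda>n. cmod (u 0 n - v 0 n)" and ?a = "1 / h\<^sup>2 * \<bar>t\<bar>"
  let ?L = "(2 * \<sigma> + 2) * R powr (2 * \<sigma>) * \<bar>t\<bar>"
  have aL: "0 \<le> ?a" "0 \<le> ?L" using \<sigma> by auto
  have c: "lp_le h p C (\<lambda>n. of_real (?c n))"
    by (rule lp_le_mono[OF p C]) auto
  show "lp_le h p (exp (2 * real CARD('d) * ?a + ?L) * C) (\<lambda>n. of_real (hop_exp h ?a ?L ?c n))"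
    by (rule lp_le_hop_exp[OF p aL c]) simp
  show "exp (2 * real CARD('d) * ?a + ?L) * C
      \<le> exp ((2 * real CARD('d) / h\<^sup>2 + (2 * \<sigma> + 2) * R powr (2 * \<sigma>)) * \<bar>t\<bar>) * C"
    by (simp add: algebra_simps)
  fix n :: "real^'d" assume n: "n \<in> lattice_h h"
  have "cmod (u t n - v t n) \<le> hop_exp h ?a ?L ?c n"
    by (rule hop_exp_on_segment[OF \<sigma> lam R seg u v bu bv _ n]) auto
  then show "cmod (u t n - v t n) \<le> cmod (of_real (hop_exp h ?a ?L ?c n))"
    by simp
qed

text \<open>The real factor \<phi> may depend on time, so the estimate covers the original equation
  as well as the one with a moving truncation level.\<close>

lemma hop_exp_growth:
  fixes u :: "real \<Rightarrow> real^'d \<Rightarrow> complex"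
  assumes der: "\<And>s n. s \<in> closed_segment 0 t \<Longrightarrow> n \<in> lattice_h h \<Longrightarrow>
      ((\<lambda>s. u s n) has_vector_derivative dnls_field h V lam (\<lambda>z. of_real (\<phi> s z) * z) (u s) n)
        (at s within closed_segment 0 t)"
    and bd: "\<And>s n. s \<in> closed_segment 0 t \<Longrightarrow> n \<in> lattice_h h \<Longrightarrow> cmod (u s n) \<le> M"
    and s: "s \<in> closed_segment 0 t" and n: "n \<in> lattice_h h"
  shows "cmod (u s n) \<le> hop_exp h (1 / h\<^sup>2 * \<bar>t\<bar>) 0 (\<lambda>m. cmod (u 0 m)) n"
  using comparison[where L = 0, OF _ _ der dnls_field_growth bd s n] by simp

lemma lp_le_hop_exp_growth:
  fixes u0 :: "real^'d \<Rightarrow> complex"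
  assumes "1 \<le> p" "lp_le h p C u0"
  shows "lp_le h p (exp (2 * real CARD('d) * \<bar>t\<bar> / h\<^sup>2) * C)
    (\<lambda>n. of_real (hop_exp h (1 / h\<^sup>2 * \<bar>t\<bar>) 0 (\<lambda>m. cmod (u0 m)) n))"
  using lp_le_hop_exp[where a = "1 / h\<^sup>2 * \<bar>t\<bar>" and L = 0, OF assms(1) _ _ lp_le_mono[OF assms order_refl]]
  by simp

lemma lp_le_dnls:
  fixes u :: "real \<Rightarrow> real^'d \<Rightarrow> complex"
  assumes p: "1 \<le> p" and seg: "closed_segment 0 t \<subseteq> I" and u: "dnls_equation h V lam \<sigma> I u"
    and bd: "\<And>s n. s \<in> closed_segment 0 t \<Longrightarrow> n \<in> lattice_h h \<Longrightarrow> cmod (u s n) \<le> M"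
    and C: "lp_le h p C (u 0)"
  shows "lp_le h p (exp (2 * real CARD('d) * \<bar>t\<bar> / h\<^sup>2) * C) (u t)"
proof (rule lp_le_mono[OF p lp_le_hop_exp_growth[OF p C, of t] order_refl])
  fix n :: "real^'d" assume n: "n \<in> lattice_h h"
  have "cmod (u t n) \<le> hop_exp h (1 / h\<^sup>2 * \<bar>t\<bar>) 0 (\<lambda>m. cmod (u 0 m)) n"
  proof (rule hop_exp_growth[OF _ bd _ n])
    fix s and m :: "real^'d" assume "s \<in> closed_segment 0 t" "m \<in> lattice_h h"
    then show "((\<lambda>s. u s m) has_vector_derivative
        dnls_field h V lam (\<lambda>z. of_real (cmod z powr (2 * \<sigma>)) * z) (u s) m) (at s within closed_segment 0 t)"
      using u seg unfolding dnls_equation_iff by (meson has_vector_derivative_within_subset subsetD)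
  qed auto
  then show "cmod (u t n) \<le> cmod (complex_of_real (hop_exp h (1 / h\<^sup>2 * \<bar>t\<bar>) 0 (\<lambda>m. cmod (u 0 m)) n))"
    by simp
qed

section \<open>Strong solutions: local boundedness, growth bound and uniqueness\<close>

lemma lp_space_diff:
  assumes "1 \<le> p" "u \<in> lp_space h p" "v \<in> lp_space h p"
  shows "(\<lambda>n. u n - v n) \<in> lp_space h p"
  using lp_le_add[OF assms(1) lp_le_lp_norm[OF assms(2)] lp_le_scaleR[OF assms(1) lp_le_lp_norm[OF assms(3)], of "-1"]]
  by (simp add: lp_le_def)

lemma lp_norm_triangle_sub:
  assumes "1 \<le> p" "u \<in> lp_space h p" "v \<in> lp_space h p"
  shows "lp_norm h p u \<le> lp_norm h p v + lp_norm h p (\<lambda>n. u n - v n)"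
  using lp_le_add[OF assms(1) lp_le_lp_norm[OF assms(3)] lp_le_lp_norm[OF lp_space_diff[OF assms]]]
  by (simp add: lp_le_def)

lemma abs_lp_norm_diff_le:
  assumes "1 \<le> p" "u \<in> lp_space h p" "v \<in> lp_space h p"
  shows "\<bar>lp_norm h p u - lp_norm h p v\<bar> \<le> lp_norm h p (\<lambda>n. u n - v n)"
proof -
  have "lp_le h p (lp_norm h p (\<lambda>n. u n - v n)) (\<lambda>n. v n - u n)"
    by (rule lp_le_mono[OF assms(1) lp_le_lp_norm[OF lp_space_diff[OF assms]] order_refl])
      (simp add: norm_minus_commute)
  then have "lp_norm h p (\<lambda>n. v n - u n) \<le> lp_norm h p (\<lambda>n. u n - v n)"
    by (simp add: lp_le_def)
  then show ?thesis
    using lp_norm_triangle_sub[OF assms] lp_norm_triangle_sub[OF assms(1,3,2)] by linarith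
qed

text \<open>By the reverse triangle inequality the norm is continuous along the path, hence bounded
  on compact sets, and it controls every component. This provides the a priori bound required by the
  comparison.\<close>

lemma lp_continuous_on_bounded:
  fixes u :: "real \<Rightarrow> real^'d \<Rightarrow> complex"
  assumes p: "1 \<le> p" and u: "lp_continuous_on h p I u" and S: "compact S" "S \<subseteq> I"
  shows "\<exists>R\<ge>0. \<forall>s\<in>S. \<forall>n\<in>lattice_h h. cmod (u s n) \<le> R"
proof -
  have "continuous_on I (\<lambda>s. lp_norm h p (u s))"
    unfolding continuous_on_def
  proof
    fix t assume t: "t \<in> I"
    have "((\<lambda>s. lp_norm h p (u s) - lp_norm h p (u t)) \<longlongrightarrow> 0) (at t within I)"
    proof (rule Lim_null_comparison)
      show "((\<lambda>s. lp_norm h p (\<lambda>n. u s n - u t n)) \<longlongrightarrow> 0) (at t within I)"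
        using u t by (simp add: lp_continuous_on_def)
      have "norm (lp_norm h p (u s) - lp_norm h p (u t)) \<le> lp_norm h p (\<lambda>n. u s n - u t n)" if "s \<in> I" for s
        using abs_lp_norm_diff_le[OF p, of "u s" h "u t"] u t that by (simp add: lp_continuous_on_def)
      then show "\<forall>\<^sub>F s in at t within I. norm (lp_norm h p (u s) - lp_norm h p (u t))
          \<le> lp_norm h p (\<lambda>n. u s n - u t n)"
        by (auto simp: eventually_at_filter)
    qed
    then show "((\<lambda>s. lp_norm h p (u s)) \<longlongrightarrow> lp_norm h p (u t)) (at t within I)"
      by (simp add: LIM_zero_iff)
  qed
  then have "compact ((\<lambda>s. lp_norm h p (u s)) ` S)"
    using S by (intro compact_continuous_image) (auto intro: continuous_on_subset)
  then have "bounded ((\<lambda>s. lp_norm h p (u s)) ` S)"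
    by (rule compact_imp_bounded)
  then obtain R where R: "\<And>s. s \<in> S \<Longrightarrow> \<bar>lp_norm h p (u s)\<bar> \<le> R"
    unfolding bounded_iff by auto
  show ?thesis
  proof (intro exI[of _ "\<bar>R\<bar>"] conjI ballI)
    fix s and n :: "real^'d" assume s: "s \<in> S" and n: "n \<in> lattice_h h"
    have "u s \<in> lp_space h p" using u s S by (auto simp: lp_continuous_on_def)
    from lp_le_coord[OF p lp_le_lp_norm[OF this] n] R[OF s] show "cmod (u s n) \<le> \<bar>R\<bar>" by simp
  qed simp
qed

lemma dnls_equation_subset:
  "dnls_equation h V lam \<sigma> J u \<Longrightarrow> I \<subseteq> J \<Longrightarrow> dnls_equation h V lam \<sigma> I u"
  unfolding dnls_equation_iff by (meson has_vector_derivative_within_subset subsetD)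

lemma lp_continuous_on_subset:
  "lp_continuous_on h p J u \<Longrightarrow> I \<subseteq> J \<Longrightarrow> lp_continuous_on h p I u"
  unfolding lp_continuous_on_def by (meson tendsto_within_subset subsetD)

lemma strong_solution_subset:
  "strong_solution h p (dnls_equation h V lam \<sigma>) J u0 u \<Longrightarrow> I \<subseteq> J \<Longrightarrow>
    strong_solution h p (dnls_equation h V lam \<sigma>) I u0 u"
  unfolding strong_solution_def using dnls_equation_subset lp_continuous_on_subset by blast

lemma strong_solution_lp_le:
  fixes u :: "real \<Rightarrow> real^'d \<Rightarrow> complex"
  assumes p: "1 \<le> p" and u: "strong_solution h p (dnls_equation h V lam \<sigma>) I u0 u"
    and seg: "closed_segment 0 t \<subseteq> I" and C: "lp_le h p C u0"
  shows "lp_le h p (exp (2 * real CARD('d) * \<bar>t\<bar> / h\<^sup>2) * C) (u t)"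
proof -
  from u have uc: "lp_continuous_on h p I u" and ue: "dnls_equation h V lam \<sigma> I u"
    and u0: "\<And>n. n \<in> lattice_h h \<Longrightarrow> u 0 n = u0 n"
    by (auto simp: strong_solution_def)
  obtain R where R: "\<forall>s\<in>closed_segment 0 t. \<forall>n\<in>lattice_h h. cmod (u s n) \<le> R"
    using lp_continuous_on_bounded[OF p uc compact_segment seg] by blast
  have C0: "lp_le h p C (u 0)"
    by (rule lp_le_mono[OF p C order_refl]) (simp add: u0)
  show ?thesis
    by (rule lp_le_dnls[OF p seg ue _ C0]) (use R in auto)
qed

text \<open>Continuity in l^p alone bounds both solutions on the segment from 0 to \<open>t\<close>,
  so the larger bound can serve as truncation level and the initial difference 0 propagates.\<close>

lemma dnls_unconditional_uniqueness:
  assumes "0 < \<sigma>" "1 \<le> p" "\<bar>lam\<bar> \<le> 1"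
  shows "unconditional_uniqueness h p (dnls_equation h (V :: real^'d \<Rightarrow> real) lam \<sigma>)"
  unfolding unconditional_uniqueness_def
proof (intro ballI allI impI)
  fix u0 :: "real^'d \<Rightarrow> complex" and I u v t and n :: "real^'d"
  assume H: "is_interval I \<and> 0 \<in> I \<and> strong_solution h p (dnls_equation h V lam \<sigma>) I u0 u \<and>
      strong_solution h p (dnls_equation h V lam \<sigma>) I u0 v" and t: "t \<in> I" and n: "n \<in> lattice_h h"
  have seg: "closed_segment 0 t \<subseteq> I"
    using H t by (intro closed_segment_subset is_interval_convex) auto
  from H have uc: "lp_continuous_on h p I u" and ue: "dnls_equation h V lam \<sigma> I u"
    and vc: "lp_continuous_on h p I v" and ve: "dnls_equation h V lam \<sigma> I v"
    and uv0: "\<And>n. n \<in> lattice_h h \<Longrightarrow> u 0 n - v 0 n = 0"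
    by (auto simp: strong_solution_def)
  obtain A where A: "0 \<le> A" "\<forall>s\<in>closed_segment 0 t. \<forall>n\<in>lattice_h h. cmod (u s n) \<le> A"
    using lp_continuous_on_bounded[OF assms(2) uc compact_segment seg] by blast
  obtain B where B: "0 \<le> B" "\<forall>s\<in>closed_segment 0 t. \<forall>n\<in>lattice_h h. cmod (v s n) \<le> B"
    using lp_continuous_on_bounded[OF assms(2) vc compact_segment seg] by blast
  have "lp_le h p 0 (\<lambda>n. u 0 n - v 0 n)"
    by (rule lp_le_mono[OF assms(2) lp_le_zero[OF assms(2)] order_refl]) (simp add: uv0)
  then have "lp_le h p (exp ((2 * real CARD('d) / h\<^sup>2 + (2 * \<sigma> + 2) * max A B powr (2 * \<sigma>)) * \<bar>t\<bar>) * 0)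
      (\<lambda>n. u t n - v t n)"
    using A B by (intro lp_le_dnls_diff[OF assms(1,3) _ assms(2) seg ue ve]) (auto simp: le_max_iff_disj)
  from lp_le_coord[OF assms(2) this n] show "u t n = v t n" by simp
qed

subsection \<open>Global existence and continuous dependence\<close>

lemma continuous_on_dnls_field_cut:
  fixes v :: "real \<Rightarrow> real^'d \<Rightarrow> complex"
  assumes "0 < \<sigma>" "n \<in> lattice_h h" "continuous_on UNIV R" "\<And>t. 0 \<le> R t"
    and v: "\<And>m. m \<in> lattice_h h \<Longrightarrow> continuous_on UNIV (\<lambda>t. v t m)"
  shows "continuous_on UNIV (\<lambda>t. dnls_field h V lam (cut (R t) \<sigma>) (v t) n)"
proof -
  have amplitude: "continuous_on UNIV (\<lambda>t. min (cmod (v t n)) (R t) powr (2 * \<sigma>))"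
    using assms(1,4) by (intro continuous_on_powr' continuous_on_min continuous_on_norm
        continuous_on_const assms(3) v[OF assms(2)]) auto
  have laplacian: "continuous_on UNIV (\<lambda>t. laplacian_h h (v t) n)"
    unfolding laplacian_h_def by (intro continuous_intros v lattice_h_neighbours assms(2))
  show ?thesis
    unfolding dnls_field_def cut_def
    by (intro continuous_on_mult continuous_on_diff continuous_on_of_real continuous_on_const
        amplitude laplacian v assms(2))
qed

lemma norm_increment_le:
  fixes x :: "real \<Rightarrow> 'b::real_normed_vector"
  assumes "\<And>r. (x has_vector_derivative x' r) (at r)" "\<And>r. r \<in> {-T..T} \<Longrightarrow> norm (x' r) \<le> B"
    and "s \<in> {-T..T}" "t \<in> {-T..T}"
  shows "norm (x s - x t) \<le> B * \<bar>s - t\<bar>"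
proof -
  have *: "norm (x s - x t) \<le> B * \<bar>s - t\<bar>" if "t < s" "s \<in> {-T..T}" "t \<in> {-T..T}" for s t
  proof -
    have "((\<lambda>r. B * r) has_vector_derivative B) (at r)" for r
      unfolding has_real_derivative_iff_has_vector_derivative[symmetric]
      by (auto intro!: derivative_eq_intros)
    then have "norm (x s - x t) \<le> B * s - B * t"
      using that assms(1,2)
      by (intro differentiable_bound_general[where f' = x' and \<phi>' = "\<lambda>_. B"] continuous_at_imp_continuous_on)
        (auto intro: has_vector_derivative_continuous)
    then show ?thesis using that by (simp add: algebra_simps)
  qed
  consider "t < s" | "s < t" | "s = t" by linarith
  then show ?thesis
    using *[of t s] *[of s t] assms(3,4) by cases (auto simp: norm_minus_commute abs_minus_commute)
qed

lemma dnls_global_solution: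
  fixes u0 :: "real^'d \<Rightarrow> complex" and V :: "real^'d \<Rightarrow> real"
  assumes \<sigma>: "0 < \<sigma>" and p: "1 \<le> p" and lam: "\<bar>lam\<bar> \<le> 1"
    and V: "\<And>n. n \<in> lattice_h h \<Longrightarrow> \<bar>V n\<bar> \<le> B" and u0: "u0 \<in> lp_space h p"
  obtains u where "strong_solution h p (dnls_equation h V lam \<sigma>) UNIV u0 u"
proof -
  define S where "S = lp_norm h p u0"
  \<comment> \<open>The truncation level is exactly the growth bound that the solution will turn out
    to satisfy.\<close>
  define R where "R t = exp (2 * real CARD('d) * \<bar>t\<bar> / h\<^sup>2) * S" for t
  define \<Lambda> where "\<Lambda> T = 2 * real CARD('d) / h\<^sup>2 + B + (2 * \<sigma> + 2) * R T powr (2 * \<sigma>)" for T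
  have S: "lp_le h p S u0" using u0 by (simp add: S_def lp_le_lp_norm)
  have S0: "0 \<le> S" by (rule lp_le_nonneg[OF S])
  have R0: "0 \<le> R t" for t using S0 by (simp add: R_def)
  have R_mono: "R t \<le> R T" if "\<bar>t\<bar> \<le> T" for t T
    unfolding R_def using that S0 by (intro mult_right_mono) (auto intro!: divide_right_mono mult_left_mono)
  have R_cont: "continuous_on UNIV R"
    unfolding R_def[abs_def] divide_inverse
    by (intro continuous_on_mult continuous_on_exp continuous_on_const continuous_on_rabs continuous_on_id)
  have B: "0 \<le> B" using V[OF lattice_h_0] by simp
  have \<Lambda>0: "0 \<le> \<Lambda> T" for T using B \<sigma> by (simp add: \<Lambda>_def)
  have lip: "cmod (cut (R t) \<sigma> z - cut (R t) \<sigma> w) \<le> (2 * \<sigma> + 2) * R T powr (2 * \<sigma>) * cmod (z - w)"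
    if "\<bar>t\<bar> \<le> T" for t T z w
  proof -
    have "(2 * \<sigma> + 2) * R t powr (2 * \<sigma>) * cmod (z - w) \<le> (2 * \<sigma> + 2) * R T powr (2 * \<sigma>) * cmod (z - w)"
      using R_mono[OF that] R0 \<sigma> by (intro mult_right_mono mult_left_mono powr_mono2) auto
    with cut_lipschitz[OF \<sigma> R0] show ?thesis by (rule order_trans)
  qed
  define F where "F t = dnls_field h V lam (cut (R t) \<sigma>)" for t
  have F_diff: "cmod (F t v n - F t w n) \<le> hop h (1 / h\<^sup>2) (\<Lambda> T) (\<lambda>m. cmod (v m - w m)) n"
    if "\<bar>t\<bar> \<le> T" "n \<in> lattice_h h" for t T v w n
    unfolding F_def \<Lambda>_def
    by (rule norm_dnls_field_diff_le[where V = V, OF lam lip[OF that(1)] V[OF that(2)]])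
  \<comment> \<open>The field vanishes on the zero sequence, so comparison with 0 bounds the field
    itself.\<close>
  have F_le: "cmod (F t v n) \<le> hop h (1 / h\<^sup>2) (\<Lambda> T) (\<lambda>m. cmod (v m)) n"
    if "\<bar>t\<bar> \<le> T" "n \<in> lattice_h h" for t T v n
    using F_diff[OF that, of v "\<lambda>_. 0"] by (simp add: F_def dnls_field_def laplacian_h_def)
  have hop_le: "hop h (1 / h\<^sup>2) (\<Lambda> T) c n \<le> (2 * real CARD('d) * (1 / h\<^sup>2) + \<Lambda> T) * \<delta>"
    if "\<And>m. m \<in> lattice_h h \<Longrightarrow> c m \<le> \<delta>" "n \<in> lattice_h h" for T \<delta> n and c :: "real^'d \<Rightarrow> real"
    using hop_mono[of "1 / h\<^sup>2" "\<Lambda> T" h c "\<lambda>_. \<delta>" n] that \<Lambda>0[of T] by (simp only: hop_const) simp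
  obtain u where init: "\<And>n. n \<in> lattice_h h \<Longrightarrow> u 0 n = u0 n"
    and der: "\<And>n t. n \<in> lattice_h h \<Longrightarrow> ((\<lambda>t. u t n) has_vector_derivative F t (u t) n) (at t)"
    and bdd: "\<And>T. \<exists>M. \<forall>t. \<bar>t\<bar> \<le> T \<longrightarrow> (\<forall>n\<in>lattice_h h. cmod (u t n - u0 n) \<le> M)"
  proof (rule picard_infinite_system[of "lattice_h h" F u0])
    show "\<exists>\<Lambda>\<ge>0. \<forall>t v w \<delta>. \<bar>t\<bar> \<le> T \<longrightarrow> (\<forall>n\<in>lattice_h h. cmod (v n - w n) \<le> \<delta>) \<longrightarrow>
        (\<forall>n\<in>lattice_h h. cmod (F t v n - F t w n) \<le> \<Lambda> * \<delta>)" for T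
      using \<Lambda>0[of T]
      by (intro exI[of _ "2 * real CARD('d) * (1 / h\<^sup>2) + \<Lambda> T"] conjI allI impI ballI
          order_trans[OF F_diff hop_le]) auto
    show "\<exists>K. \<forall>t. \<bar>t\<bar> \<le> T \<longrightarrow> (\<forall>n\<in>lattice_h h. cmod (F t u0 n) \<le> K)" for T
      using lp_le_coord[OF p S]
      by (intro exI[of _ "(2 * real CARD('d) * (1 / h\<^sup>2) + \<Lambda> T) * S"] allI impI ballI
          order_trans[OF F_le hop_le]) auto
    show "continuous_on UNIV (\<lambda>t. F t (v t) n)"
      if "n \<in> lattice_h h" "\<And>m. m \<in> lattice_h h \<Longrightarrow> continuous_on UNIV (\<lambda>t. v t m)" for v n
      unfolding F_def using \<sigma> that R0 R_cont by (intro continuous_on_dnls_field_cut) auto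
  qed blast
  define g where "g T = hop_exp h (1 / h\<^sup>2 * \<bar>T\<bar>) 0 (\<lambda>m. cmod (u 0 m))" for T
  have u_0: "lp_le h p S (u 0)"
    by (rule lp_le_mono[OF p S order_refl]) (simp add: init)
  have g: "lp_le h p (R T) (\<lambda>n. of_real (g T n))" for T
    unfolding g_def R_def by (rule lp_le_hop_exp_growth[OF p u_0])
  have u_g: "cmod (u s n) \<le> g T n" if "s \<in> closed_segment 0 T" "n \<in> lattice_h h" for s n T
  proof -
    obtain M where M: "\<And>t n. \<bar>t\<bar> \<le> \<bar>T\<bar> \<Longrightarrow> n \<in> lattice_h h \<Longrightarrow> cmod (u t n - u0 n) \<le> M"
      using bdd[of "\<bar>T\<bar>"] by blast
    have seg: "\<bar>r\<bar> \<le> \<bar>T\<bar>" if "r \<in> closed_segment 0 T" for r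
      using segment_bound1[OF that] by simp
    show ?thesis
      unfolding g_def
    proof (rule hop_exp_growth[where M = "M + S" and \<phi> = "\<lambda>s z. min (cmod z) (R s) powr (2 * \<sigma>)", OF _ _ that])
      fix r and m :: "real^'d" assume r: "r \<in> closed_segment 0 T" and m: "m \<in> lattice_h h"
      show "((\<lambda>s. u s m) has_vector_derivative
          dnls_field h V lam (\<lambda>z. of_real (min (cmod z) (R r) powr (2 * \<sigma>)) * z) (u r) m)
          (at r within closed_segment 0 T)"
        using der[OF m, of r] unfolding F_def cut_def[abs_def]
        by (rule has_vector_derivative_at_within)
      show "cmod (u r m) \<le> M + S"
        using norm_triangle_mono[OF M[OF seg[OF r] m] lp_le_coord[OF p S m]] by simp
    qed
  qed
  \<comment> \<open>The solution never exceeds its truncation level, so it solves the original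
    equation.\<close>
  have u_R: "cmod (u t n) \<le> R t" if "n \<in> lattice_h h" for t n
    using u_g[of t t n] lp_le_coord[OF p g[of t] that] that by simp
  have u_lp: "u t \<in> lp_space h p" for t
    using lp_le_mono[OF p g[of t] order_refl, of "u t"] u_g[of t t] by (force simp: lp_le_def)
  have "dnls_equation h V lam \<sigma> UNIV u"
    using der dnls_field_cut[of "u _" _, OF u_R] by (simp add: dnls_equation_iff F_def)
  moreover have "lp_continuous_on h p UNIV u"
    unfolding lp_continuous_on_def
  proof (intro ballI conjI u_lp)
    fix t :: real
    define T where "T = \<bar>t\<bar> + 1"
    define K where "K = (2 * real CARD('d) * (1 / h\<^sup>2) + \<Lambda> T) * R T"
    have T: "0 \<le> T" by (simp add: T_def)
    \<comment> \<open>On [-T, T] the speed of every component is dominated by one fixed l^p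
      function, \<open>hop\<close> applied to \<open>g T\<close>; hence the path is Lipschitz in
      l^p.\<close>
    have Lip: "lp_le h p (\<bar>s - t\<bar> * K) (\<lambda>n. u s n - u t n)" if s: "s \<in> {-T..T}" for s
    proof (rule lp_le_mono[OF p lp_le_scaleR[OF p lp_le_hop[OF p _ \<Lambda>0 g]]])
      fix n :: "real^'d" assume n: "n \<in> lattice_h h"
      have "cmod (u s n - u t n) \<le> hop h (1 / h\<^sup>2) (\<Lambda> T) (g T) n * \<bar>s - t\<bar>"
      proof (rule norm_increment_le[OF der[OF n] _ s])
        show "t \<in> {-T..T}" by (auto simp: T_def)
        fix r assume r: "r \<in> {-T..T}"
        have "cmod (F r (u r) n) \<le> hop h (1 / h\<^sup>2) (\<Lambda> T) (\<lambda>m. cmod (u r m)) n"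
          using r n by (intro F_le) auto
        also have "\<dots> \<le> hop h (1 / h\<^sup>2) (\<Lambda> T) (g T) n"
        proof (intro hop_mono \<Lambda>0 n)
          fix m :: "real^'d" assume m: "m \<in> lattice_h h"
          \<comment> \<open>Evenness of \<open>g\<close> lets one function dominate at positive and
            negative times alike.\<close>
          have "g (- T) = g T" by (simp add: g_def)
          then show "cmod (u r m) \<le> g T m"
            using r u_g[of r T m] u_g[of r "- T" m] m T
            by (cases "0 \<le> r") (auto simp: closed_segment_eq_real_ivl)
        qed simp
        finally show "cmod (F r (u r) n) \<le> hop h (1 / h\<^sup>2) (\<Lambda> T) (g T) n" .
      qed
      also have "\<dots> \<le> cmod ((s - t) *\<^sub>R complex_of_real (hop h (1 / h\<^sup>2) (\<Lambda> T) (g T) n))"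
        by (simp add: norm_mult mult.commute mult_left_mono)
      finally show "cmod (u s n - u t n) \<le> \<dots>" .
    qed (auto simp: K_def)
    show "((\<lambda>s. lp_norm h p (\<lambda>n. u s n - u t n)) \<longlongrightarrow> 0) (at t within UNIV)"
    proof (rule Lim_null_comparison)
      have "((\<lambda>s. \<bar>s - t\<bar> * K) \<longlongrightarrow> \<bar>t - t\<bar> * K) (at t)"
        by (intro tendsto_intros)
      then show "((\<lambda>s. \<bar>s - t\<bar> * K) \<longlongrightarrow> 0) (at t)" by simp
      have "\<forall>\<^sub>F s in at t. s \<in> {-T<..<T}"
        by (rule eventually_at_in_open') (auto simp: T_def)
      then show "\<forall>\<^sub>F s in at t. norm (lp_norm h p (\<lambda>n. u s n - u t n)) \<le> \<bar>s - t\<bar> * K"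
      proof eventually_elim
        case (elim s)
        then show ?case
          using Lip[of s] lp_norm_nonneg[OF lp_space_diff[OF p u_lp u_lp]] by (auto simp: lp_le_def)
      qed
    qed
  qed
  ultimately show thesis
    using that init by (auto simp: strong_solution_def)
qed

text \<open>On a smaller interval uniqueness would make the global solution a proper extension,
  against maximality.\<close>

lemma dnls_maximal_interval:
  fixes V :: "real^'d \<Rightarrow> real"
  assumes \<sigma>: "0 < \<sigma>" and p: "1 \<le> p" and lam: "\<bar>lam\<bar> \<le> 1"
    and V: "\<And>n. n \<in> lattice_h h \<Longrightarrow> \<bar>V n\<bar> \<le> B" and u0: "u0 \<in> lp_space h p"
    and max: "maximal_solution h p (dnls_equation h V lam \<sigma>) Tmin Tmax u0 u"
  shows "einterval (- Tmin) Tmax = UNIV"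
proof (rule ccontr)
  let ?I = "einterval (- Tmin) Tmax"
  assume "?I \<noteq> UNIV"
  then have sub: "?I \<subset> UNIV" by auto
  obtain v where v: "strong_solution h p (dnls_equation h V lam \<sigma>) UNIV u0 v"
    by (rule dnls_global_solution[where V = V, OF \<sigma> p lam V u0])
  have "is_interval ?I"
    unfolding is_interval_1
  proof (intro ballI allI impI)
    fix a b x assume "a \<in> ?I" "b \<in> ?I" "a \<le> x \<and> x \<le> b"
    then show "x \<in> ?I"
      using less_le_trans[of "- Tmin" "ereal a" "ereal x"] le_less_trans[of "ereal x" "ereal b" Tmax]
      by (simp add: einterval_def)
  qed
  moreover have "0 \<in> ?I"
  proof -
    have "0 < Tmin" "0 < Tmax" using max by (simp_all add: maximal_solution_def)
    then show ?thesis by (cases Tmin) (auto simp: einterval_def zero_ereal_def)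
  qed
  ultimately have I: "is_interval ?I" "0 \<in> ?I" by simp_all
  have "strong_solution h p (dnls_equation h V lam \<sigma>) ?I u0 u"
    using max by (simp add: maximal_solution_def)
  moreover have "strong_solution h p (dnls_equation h V lam \<sigma>) ?I u0 v"
    by (rule strong_solution_subset[OF v]) simp
  ultimately have "\<forall>t\<in>?I. \<forall>n\<in>lattice_h h. v t n = u t n"
    using dnls_unconditional_uniqueness[OF \<sigma> p lam, of h V] u0 I
    unfolding unconditional_uniqueness_def by metis
  with v sub max show False
    unfolding maximal_solution_def using is_interval_univ by blast
qed

text \<open>Convergent data are bounded in norm, so all solutions share one bound \<open>R\<close>
  on the compact time interval. The difference estimate then has a factor independent of
  \<open>k\<close>.\<close>

lemma dnls_continuous_dependence:
  fixes V :: "real^'d \<Rightarrow> real"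
  assumes \<sigma>: "0 < \<sigma>" and p: "1 \<le> p" and lam: "\<bar>lam\<bar> \<le> 1"
    and V: "\<And>n. n \<in> lattice_h h \<Longrightarrow> \<bar>V n\<bar> \<le> B"
  shows "continuous_dependence h p (dnls_equation h V lam \<sigma>)"
  unfolding continuous_dependence_def
proof (intro allI impI, elim conjE)
  fix u0 and u :: "real \<Rightarrow> real^'d \<Rightarrow> complex" and Tmin Tmax u0k uk Tmink Tmaxk and a b :: real
  assume u0: "u0 \<in> lp_space h p" and u0k: "\<forall>k::nat. u0k k \<in> lp_space h p"
    and lim: "(\<lambda>k. lp_norm h p (\<lambda>n. u0k k n - u0 n)) \<longlonglongrightarrow> 0"
    and u: "maximal_solution h p (dnls_equation h V lam \<sigma>) Tmin Tmax u0 u"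
    and uk: "\<forall>k. maximal_solution h p (dnls_equation h V lam \<sigma>) (Tmink k) (Tmaxk k) (u0k k) (uk k)"
  define d where "d k = lp_norm h p (\<lambda>n. u0k k n - u0 n)" for k
  have dk: "lp_le h p (d k) (\<lambda>n. u0k k n - u0 n)" for k
    unfolding d_def using u0 u0k p by (intro lp_le_lp_norm lp_space_diff) auto
  note ivl = dnls_maximal_interval[where V = V, OF \<sigma> p lam V]
  have I: "einterval (- Tmin) Tmax = UNIV" and Ik: "einterval (- Tmink k) (Tmaxk k) = UNIV" for k
    using ivl[OF _ u0 u] ivl[OF _ u0k[rule_format] uk[rule_format]] by auto
  have su: "strong_solution h p (dnls_equation h V lam \<sigma>) UNIV u0 u"
    and suk: "strong_solution h p (dnls_equation h V lam \<sigma>) UNIV (u0k k) (uk k)" for k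
    using u uk I Ik by (auto simp: maximal_solution_def)
  obtain D where D: "\<And>k. d k \<le> D"
    using convergent_imp_Bseq[OF convergentI[OF lim]] unfolding Bseq_def d_def
    by (metis abs_le_D1 real_norm_def)
  define N where "N = lp_norm h p u0 + D"
  have D0: "0 \<le> D" using D[of 0] lp_le_nonneg[OF dk[of 0]] by simp
  have N: "lp_le h p N u0" and Nk: "lp_le h p N (u0k k)" for k
  proof -
    show "lp_le h p N u0"
      using D0 by (intro lp_le_mono[OF p lp_le_lp_norm[OF u0]]) (auto simp: N_def)
    have "lp_le h p (lp_norm h p u0 + d k) (\<lambda>n. u0 n + (u0k k n - u0 n))"
      by (rule lp_le_add[OF p lp_le_lp_norm[OF u0] dk])
    from lp_le_mono[OF p this, of N "u0k k"] show "lp_le h p N (u0k k)"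
      using D[of k] by (simp add: N_def)
  qed
  define T where "T = max \<bar>a\<bar> \<bar>b\<bar>"
  define R where "R = exp (2 * real CARD('d) * T / h\<^sup>2) * N"
  have R0: "0 \<le> R" using lp_le_nonneg[OF N] by (simp add: R_def)
  have bound: "cmod (w s n) \<le> R"
    if w: "strong_solution h p (dnls_equation h V lam \<sigma>) UNIV w0 w" and w0: "lp_le h p N w0"
      and "\<bar>s\<bar> \<le> T" "n \<in> lattice_h h" for w w0 s n
  proof -
    have "cmod (w s n) \<le> exp (2 * real CARD('d) * \<bar>s\<bar> / h\<^sup>2) * N"
      by (rule lp_le_coord[OF p strong_solution_lp_le[OF p w _ w0] that(4)]) simp
    also have "\<dots> \<le> R"
      unfolding R_def using that(3) lp_le_nonneg[OF N]
      by (intro mult_right_mono) (auto intro!: divide_right_mono mult_left_mono)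
    finally show ?thesis .
  qed
  define L where "L = 2 * real CARD('d) / h\<^sup>2 + (2 * \<sigma> + 2) * R powr (2 * \<sigma>)"
  have L0: "0 \<le> L" using \<sigma> by (simp add: L_def)
  have est: "lp_le h p (exp (L * T) * d k) (\<lambda>n. uk k t n - u t n)" if t: "t \<in> {a..b}" for k t
  proof -
    have tT: "\<bar>t\<bar> \<le> T" using t by (auto simp: T_def)
    have seg: "\<bar>s\<bar> \<le> T" if "s \<in> closed_segment 0 t" for s
      using segment_bound1[OF that] tT by simp
    have "lp_le h p (d k) (\<lambda>n. uk k 0 n - u 0 n)"
      using su suk[of k] by (intro lp_le_mono[OF p dk order_refl]) (simp add: strong_solution_def)
    then have "lp_le h p (exp (L * \<bar>t\<bar>) * d k) (\<lambda>n. uk k t n - u t n)"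
      unfolding L_def using su suk[of k] seg
      by (intro lp_le_dnls_diff[OF \<sigma> lam R0 p subset_UNIV] bound[OF su N] bound[OF suk Nk])
        (auto simp: strong_solution_def)
    moreover have "exp (L * \<bar>t\<bar>) * d k \<le> exp (L * T) * d k"
      using tT L0 lp_le_nonneg[OF dk] by (intro mult_right_mono) (auto intro: mult_left_mono)
    ultimately show ?thesis by (rule lp_le_mono[OF p]) simp
  qed
  have "(\<lambda>k. exp (L * T) * d k) \<longlonglongrightarrow> exp (L * T) * 0"
    unfolding d_def by (intro tendsto_intros lim)
  then have est_lim: "(\<lambda>k. exp (L * T) * d k) \<longlonglongrightarrow> 0" by simp
  have "uniform_limit {a..b} (\<lambda>k t. lp_norm h p (\<lambda>n. uk k t n - u t n)) (\<lambda>_. 0) sequentially"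
  proof (rule uniform_limitI)
    fix e :: real assume "0 < e"
    from order_tendstoD(2)[OF est_lim this]
    show "\<forall>\<^sub>F k in sequentially. \<forall>t\<in>{a..b}. dist (lp_norm h p (\<lambda>n. uk k t n - u t n)) 0 < e"
    proof eventually_elim
      case (elim k)
      show ?case
      proof
        fix t assume "t \<in> {a..b}"
        from est[OF this, of k] elim show "dist (lp_norm h p (\<lambda>n. uk k t n - u t n)) 0 < e"
          using lp_norm_nonneg[of "\<lambda>n. uk k t n - u t n" h p] by (simp add: lp_le_def)
      qed
    qed
  qed
  then show "(\<forall>\<^sub>F k in sequentially. {a..b} \<subseteq> einterval (- Tmink k) (Tmaxk k)) \<and>
      uniform_limit {a..b} (\<lambda>k t. lp_norm h p (\<lambda>n. uk k t n - u t n)) (\<lambda>_. 0) sequentially"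
    by (simp add: Ik)
qed

theorem theorem1p3:
  fixes h \<sigma> lam :: real and p :: ereal and V :: "real^'d \<Rightarrow> real"
  assumes "0 < h" and "0 < \<sigma>" and "1 \<le> p" and "lam \<in> {1, -1}"
    and "bounded (V ` lattice_h h)"
  shows "globally_well_posed h p (dnls_equation h V lam \<sigma>) \<and>
    (\<forall>u0\<in>lp_space h p. \<forall>u. strong_solution h p (dnls_equation h V lam \<sigma>) UNIV u0 u \<longrightarrow>
       (\<forall>t. lp_norm h p (u t) \<le> exp (2 * real CARD('d) * \<bar>t\<bar> / h\<^sup>2) * lp_norm h p u0))"
proof (intro conjI ballI allI impI)
  have lam: "\<bar>lam\<bar> \<le> 1" using assms(4) by auto
  obtain B where V: "\<And>n. n \<in> lattice_h h \<Longrightarrow> \<bar>V n\<bar> \<le> B"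
    using assms(5) unfolding bounded_iff by auto
  note params = assms(2,3) lam
  \<comment> \<open>A solution on the whole line is maximal because no interval is strictly
    larger.\<close>
  have "maximal_solution h p (dnls_equation h V lam \<sigma>) \<infinity> \<infinity> u0 u"
    if "strong_solution h p (dnls_equation h V lam \<sigma>) UNIV u0 u" for u0 u
    using that by (auto simp: maximal_solution_def)
  then have "\<forall>u0\<in>lp_space h p. \<exists>Tmin Tmax u. maximal_solution h p (dnls_equation h V lam \<sigma>) Tmin Tmax u0 u"
    by (meson dnls_global_solution[where V = V, OF params V])
  then show "globally_well_posed h p (dnls_equation h V lam \<sigma>)"
    unfolding globally_well_posed_def locally_well_posed_def
    using dnls_unconditional_uniqueness[OF params] dnls_continuous_dependence[where V = V, OF params V]
      dnls_maximal_interval[where V = V, OF params V] by blast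
  fix u0 u t
  assume "u0 \<in> lp_space h p" "strong_solution h p (dnls_equation h V lam \<sigma>) UNIV u0 u"
  from strong_solution_lp_le[OF assms(3) this(2) subset_UNIV lp_le_lp_norm[OF this(1)]]
  show "lp_norm h p (u t) \<le> exp (2 * real CARD('d) * \<bar>t\<bar> / h\<^sup>2) * lp_norm h p u0"
    by (simp add: lp_le_def)
qed

end
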